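(* There exists an infinite dimensional chaotic Banach algebra.
   Context: A Banach algebra is a complex algebra $A$, possibly without unit, equipped with a complete norm satisfying $\|ab\|\le\|a\|\,\|b\|$. Let $A^{\#}=A\oplus\mathrm{span}\{\mathbf 1\}$ be the unitalization of $A$, with unit $\mathbf 1$. An element $a\in A$ is a supercyclic element of $A$ if $\{za^n: z\in\mathbb C,\ n\in\mathbb N\}$ is dense in $A$; it is an almost hypercyclic element if $\{(\mathbf 1+a)^n a: n\in\mathbb N\}$ is dense in $A$ (products computed in $A^{\#}$); it is a chaotic element if it is both supercyclic and almost hypercyclic. $A$ is called chaotic if it has a chaotic element. Here $\mathbb N$ is the set of positive integers. *)

theory Defs
  imports Complex_Main
begin

record 'a cba =
  carrier :: "'a set"
  zero :: 'a
  add :: "'a \<Rightarrow> 'a \<Rightarrow> 'a"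
  smult :: "complex \<Rightarrow> 'a \<Rightarrow> 'a"
  mult :: "'a \<Rightarrow> 'a \<Rightarrow> 'a"
  nrm :: "'a \<Rightarrow> real"

definition sub :: "'a cba \<Rightarrow> 'a \<Rightarrow> 'a \<Rightarrow> 'a" where
  "sub A x y = add A x (smult A (-1) y)"

definition banach_algebra :: "'a cba \<Rightarrow> bool" where
  "banach_algebra A \<longleftrightarrow>
     zero A \<in> carrier A \<and>
     (\<forall>x\<in>carrier A. \<forall>y\<in>carrier A. add A x y \<in> carrier A) \<and>
     (\<forall>c. \<forall>x\<in>carrier A. smult A c x \<in> carrier A) \<and>
     (\<forall>x\<in>carrier A. \<forall>y\<in>carrier A. mult A x y \<in> carrier A) \<and>
     \<comment> \<open>complex vector space\<close>
     (\<forall>x\<in>carrier A. \<forall>y\<in>carrier A. \<forall>z\<in>carrier A. add A (add A x y) z = add A x (add A y z)) \<and>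
     (\<forall>x\<in>carrier A. \<forall>y\<in>carrier A. add A x y = add A y x) \<and>
     (\<forall>x\<in>carrier A. add A (zero A) x = x) \<and>
     (\<forall>x\<in>carrier A. add A x (smult A (-1) x) = zero A) \<and>
     (\<forall>x\<in>carrier A. smult A 1 x = x) \<and>
     (\<forall>c d. \<forall>x\<in>carrier A. smult A c (smult A d x) = smult A (c * d) x) \<and>
     (\<forall>c d. \<forall>x\<in>carrier A. smult A (c + d) x = add A (smult A c x) (smult A d x)) \<and>
     (\<forall>c. \<forall>x\<in>carrier A. \<forall>y\<in>carrier A. smult A c (add A x y) = add A (smult A c x) (smult A c y)) \<and>
     \<comment> \<open>associative bilinear multiplication\<close>
     (\<forall>x\<in>carrier A. \<forall>y\<in>carrier A. \<forall>z\<in>carrier A. mult A (mult A x y) z = mult A x (mult A y z)) \<and>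
     (\<forall>x\<in>carrier A. \<forall>y\<in>carrier A. \<forall>z\<in>carrier A. mult A (add A x y) z = add A (mult A x z) (mult A y z)) \<and>
     (\<forall>x\<in>carrier A. \<forall>y\<in>carrier A. \<forall>z\<in>carrier A. mult A x (add A y z) = add A (mult A x y) (mult A x z)) \<and>
     (\<forall>c. \<forall>x\<in>carrier A. \<forall>y\<in>carrier A. mult A (smult A c x) y = smult A c (mult A x y)) \<and>
     (\<forall>c. \<forall>x\<in>carrier A. \<forall>y\<in>carrier A. mult A x (smult A c y) = smult A c (mult A x y)) \<and>
     \<comment> \<open>submultiplicative norm\<close>
     (\<forall>x\<in>carrier A. nrm A x = 0 \<longleftrightarrow> x = zero A) \<and>
     (\<forall>x\<in>carrier A. \<forall>y\<in>carrier A. nrm A (add A x y) \<le> nrm A x + nrm A y) \<and>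
     (\<forall>c. \<forall>x\<in>carrier A. nrm A (smult A c x) = cmod c * nrm A x) \<and>
     (\<forall>x\<in>carrier A. \<forall>y\<in>carrier A. nrm A (mult A x y) \<le> nrm A x * nrm A y) \<and>
     \<comment> \<open>completeness\<close>
     (\<forall>f :: nat \<Rightarrow> 'a. (\<forall>n. f n \<in> carrier A) \<longrightarrow>
        (\<forall>e>0. \<exists>N. \<forall>m\<ge>N. \<forall>n\<ge>N. nrm A (sub A (f m) (f n)) < e) \<longrightarrow>
        (\<exists>L\<in>carrier A. \<forall>e>0. \<exists>N. \<forall>n\<ge>N. nrm A (sub A (f n) L) < e))"

fun lincomb :: "'a cba \<Rightarrow> (complex \<times> 'a) list \<Rightarrow> 'a" where
  "lincomb A [] = zero A"
| "lincomb A ((c, x) # xs) = add A (smult A c x) (lincomb A xs)"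

definition infinite_dimensional :: "'a cba \<Rightarrow> bool" where
  "infinite_dimensional A \<longleftrightarrow>
     \<not> (\<exists>xs. set xs \<subseteq> carrier A \<and>
            (\<forall>y\<in>carrier A. \<exists>cs. length cs = length xs \<and> y = lincomb A (zip cs xs)))"

definition dense_in :: "'a cba \<Rightarrow> 'a set \<Rightarrow> bool" where
  "dense_in A D \<longleftrightarrow> D \<subseteq> carrier A \<and>
     (\<forall>x\<in>carrier A. \<forall>e>0. \<exists>d\<in>D. nrm A (sub A x d) < e)"

text \<open>Powers a^n for n \<ge> 1 (the value at 0 is irrelevant).\<close>
fun apow :: "'a cba \<Rightarrow> 'a \<Rightarrow> nat \<Rightarrow> 'a" where
  "apow A a 0 = zero A"
| "apow A a (Suc 0) = a"
| "apow A a (Suc (Suc n)) = mult A a (apow A a (Suc n))"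

text \<open>Unitalization A# = A \<oplus> C1, elements (x, \<lambda>) meaning x + \<lambda>1.\<close>
definition umult :: "'a cba \<Rightarrow> 'a \<times> complex \<Rightarrow> 'a \<times> complex \<Rightarrow> 'a \<times> complex" where
  "umult A u v = (case u of (x, l) \<Rightarrow> case v of (y, m) \<Rightarrow>
      (add A (add A (mult A x y) (smult A l y)) (smult A m x), l * m))"

fun upow :: "'a cba \<Rightarrow> 'a \<times> complex \<Rightarrow> nat \<Rightarrow> 'a \<times> complex" where
  "upow A u 0 = (zero A, 1)"
| "upow A u (Suc n) = umult A u (upow A u n)"

definition supercyclic_elem :: "'a cba \<Rightarrow> 'a \<Rightarrow> bool" where
  "supercyclic_elem A a \<longleftrightarrow> a \<in> carrier A \<and>
     dense_in A {smult A z (apow A a n) | z n. n \<ge> 1}"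

definition almost_hypercyclic_elem :: "'a cba \<Rightarrow> 'a \<Rightarrow> bool" where
  "almost_hypercyclic_elem A a \<longleftrightarrow> a \<in> carrier A \<and>
     dense_in A {fst (umult A (upow A (a, 1) n) (a, 0)) | n. n \<ge> 1}"

definition chaotic_elem :: "'a cba \<Rightarrow> 'a \<Rightarrow> bool" where
  "chaotic_elem A a \<longleftrightarrow> supercyclic_elem A a \<and> almost_hypercyclic_elem A a"

definition chaotic_algebra :: "'a cba \<Rightarrow> bool" where
  "chaotic_algebra A \<longleftrightarrow> (\<exists>a\<in>carrier A. chaotic_elem A a)"

end

theory Submission
  imports Defs "HOL-Analysis.Analysis" "HOL-Computational_Algebra.Polynomial"
begin

text \<open>
  The algebra is the completion of the polynomials \<open>q\<close>, read as elements \<open>a q(a)\<close> of a singly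
  generated algebra: the product of \<open>g\<close> and \<open>h\<close> becomes \<open>z g h\<close>, the generator \<open>a\<close> is \<open>1\<close>,
  \<open>a ^ (n + 1)\<close> is \<open>z ^ n\<close> and \<open>(1 + a) ^ n a\<close> is \<open>(1 + z) ^ n\<close>. So one needs a
  submultiplicative norm on polynomials in which every polynomial is a limit of monomials
  \<open>c z ^ n\<close> and also a limit of powers \<open>(1 + z) ^ n\<close>.

  The norm is the limit of seminorms \<open>s\<^sub>k\<close> of spectral radius below \<open>d\<^sub>k\<close>, with \<open>d\<^sub>k\<close> tending
  to 0. Given \<open>s = s\<^sub>k\<close>, \<open>d = d\<^sub>k\<close>, take a monic polynomial \<open>P\<close> of large degree, very close
  to a power of \<open>z\<close>, and put \<open>s\<^sub>k\<^sub>+\<^sub>1(g) = s(g mod P) + w(g mod P)\<close> where \<open>w\<close> is the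
  \<open>l\<^sup>1\<close> norm with weights \<open>d ^ (i + 1)\<close>. Reduction modulo \<open>P\<close> almost kills high powers of
  \<open>z\<close>, and \<open>w\<close> absorbs the resulting failure of submultiplicativity. On low degrees the seminorm only
  changes by the tiny \<open>w\<close>, while \<open>s\<^sub>k\<^sub>+\<^sub>1\<close> vanishes on the multiples of \<open>P\<close>. Given a
  target \<open>q\<close>, one takes \<open>P = z ^ L - q / c\<close>, which divides \<open>q - c z ^ L\<close>, or for \<open>P\<close> a product
  over \<open>L\<close> roots of \<open>(1 + z) ^ n = q(z)\<close>; such roots of size \<open>O(1/n)\<close> exist if \<open>q(0) \<noteq> 0\<close>.
\<close>

subsection \<open>Weighted norms and seminorms on polynomials\<close>

text \<open>The exponent is \<open>Suc i\<close> because \<open>z ^ i\<close> stands for the power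
  \<open>i + 1\<close> of the generator. With this shift the norm is submultiplicative for the
  product \<open>z g h\<close>.\<close>

definition wnorm :: "real \<Rightarrow> complex poly \<Rightarrow> real" where
  "wnorm d g = (\<Sum>i\<le>degree g. cmod (coeff g i) * d ^ Suc i)"

lemma wnorm_alt:
  assumes "degree g \<le> m"
  shows "wnorm d g = (\<Sum>i\<le>m. cmod (coeff g i) * d ^ Suc i)"
  unfolding wnorm_def using assms
  by (intro sum.mono_neutral_left) (auto simp: coeff_eq_0)

lemma wnorm_nonneg: "0 \<le> d \<Longrightarrow> 0 \<le> wnorm d g"
  unfolding wnorm_def by (intro sum_nonneg) auto

lemma wnorm_add_le:
  assumes "0 \<le> d"
  shows "wnorm d (g + h) \<le> wnorm d g + wnorm d h"
proof -
  let ?m = "max (degree g) (degree h)"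
  have "wnorm d (g + h) = (\<Sum>i\<le>?m. cmod (coeff g i + coeff h i) * d ^ Suc i)"
    using wnorm_alt[of "g + h" ?m d] by (simp add: degree_add_le)
  also have "\<dots> \<le> (\<Sum>i\<le>?m. (cmod (coeff g i) + cmod (coeff h i)) * d ^ Suc i)"
    using assms by (intro sum_mono mult_right_mono norm_triangle_ineq) auto
  also have "\<dots> = wnorm d g + wnorm d h"
    by (simp only: wnorm_alt[of g ?m d] wnorm_alt[of h ?m d] max.cobounded1 max.cobounded2
        distrib_right sum.distrib)
  finally show ?thesis .
qed

lemma wnorm_scale: "wnorm d ([:c:] * g) = cmod c * wnorm d g"
  by (cases "c = 0") (auto simp: wnorm_def norm_mult sum_distrib_left mult.assoc)

lemma wnorm_monom: "wnorm d (monom c n) = cmod c * d ^ Suc n"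
proof -
  have "wnorm d (monom c n) = (\<Sum>i\<le>n. cmod (coeff (monom c n) i) * d ^ Suc i)"
    by (rule wnorm_alt) (simp add: degree_monom_le)
  also have "\<dots> = (\<Sum>i\<in>{n}. cmod (coeff (monom c n) i) * d ^ Suc i)"
    by (rule sum.mono_neutral_right) auto
  finally show ?thesis by simp
qed

lemma wnorm_one: "wnorm d 1 = d"
  by (simp add: wnorm_def)

text \<open>Every weight contains at least one factor \<open>d\<close>, so even the constant term
  shrinks by \<open>k\<close>. This yields the geometric decay of the increments in the limit
  construction.\<close>

lemma wnorm_weight_le:
  assumes "0 \<le> d" "0 \<le> k" "k \<le> 1"
  shows "wnorm (k * d) g \<le> k * wnorm d g"
proof -
  have "wnorm (k * d) g \<le> (\<Sum>i\<le>degree g. k * (cmod (coeff g i) * d ^ Suc i))"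
    unfolding wnorm_def
  proof (rule sum_mono)
    fix i
    have "k * k ^ i \<le> k * 1"
      using assms by (intro mult_left_mono power_le_one) auto
    then have "(k * k ^ i) * (cmod (coeff g i) * d ^ Suc i) \<le> k * (cmod (coeff g i) * d ^ Suc i)"
      using assms by (intro mult_right_mono) auto
    then show "cmod (coeff g i) * (k * d) ^ Suc i \<le> k * (cmod (coeff g i) * d ^ Suc i)"
      by (simp add: power_mult_distrib mult_ac)
  qed
  then show ?thesis by (simp add: wnorm_def sum_distrib_left)
qed

lemma wnorm_pos:
  assumes "0 < d" "g \<noteq> 0"
  shows "0 < wnorm d g"
proof -
  have "0 < cmod (coeff g (degree g)) * d ^ Suc (degree g)" using assms by simp
  also have "\<dots> \<le> wnorm d g"
    unfolding wnorm_def using assms by (intro member_le_sum) auto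
  finally show ?thesis .
qed

locale poly_seminorm =
  fixes s :: "complex poly \<Rightarrow> real"
  assumes add_le: "s (g + h) \<le> s g + s h"
    and scale: "s ([:c:] * g) = cmod c * s g"
begin

lemma zero: "s 0 = 0"
  using scale[of 0 0] by simp

lemma minus: "s (- g) = s g"
  using scale[of "- 1" g] by simp

lemma nonneg: "0 \<le> s g"
  using add_le[of g "- g"] by (simp add: minus zero)

lemma diff_le: "s (g - h) \<le> s g + s h"
  using add_le[of g "- h"] by (simp add: minus)

lemma diff_commute: "s (g - h) = s (h - g)"
  using minus[of "g - h"] by simp

lemma diff_triangle: "s (f - h) \<le> s (f - g) + s (g - h)"
  using add_le[of "f - g" "g - h"] by simp

lemma abs_diff_le: "\<bar>s g - s h\<bar> \<le> s (g - h)"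
  using add_le[of "g - h" h] add_le[of "h - g" g] by (simp add: diff_commute abs_le_iff)

lemma sum_le: "s (\<Sum>i\<in>I. f i) \<le> (\<Sum>i\<in>I. s (f i))"
proof (induction I rule: infinite_finite_induct)
  case (insert i I)
  then show ?case using add_le[of "f i" "\<Sum>i\<in>I. f i"] by simp
qed (auto simp: zero)

lemma monom_eq: "s (monom c n) = cmod c * s (monom 1 n)"
  using scale[of c "monom 1 n"] by (simp add: smult_monom)

lemma le_sum_coeff:
  assumes "degree g \<le> m"
  shows "s g \<le> (\<Sum>i\<le>m. cmod (coeff g i) * s (monom 1 i))"
proof -
  have "s g = s (\<Sum>i\<le>m. monom (coeff g i) i)"
    using poly_as_sum_of_monoms'[OF assms] by simp
  also have "\<dots> \<le> (\<Sum>i\<le>m. s (monom (coeff g i) i))" by (rule sum_le)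
  also have "\<dots> = (\<Sum>i\<le>m. cmod (coeff g i) * s (monom 1 i))"
    by (intro sum.cong refl monom_eq)
  finally show ?thesis .
qed

text \<open>A weighted norm of type l1 is the largest seminorm with prescribed values on the
  monomials, so domination need only be checked on monomials, and only up to the degree of
  \<open>g\<close>.\<close>

lemma le_wnorm:
  assumes "\<And>l. l \<le> degree g \<Longrightarrow> s (monom 1 l) \<le> d ^ Suc l"
  shows "s g \<le> wnorm d g"
  unfolding wnorm_def using assms
  by (rule_tac order_trans[OF le_sum_coeff[OF order_refl]]) (intro sum_mono mult_left_mono, auto)

lemma le_const_wnorm:
  obtains C where "0 < C" "\<And>g. degree g \<le> m \<Longrightarrow> s g \<le> C * wnorm 1 g"
proof
  let ?C = "1 + (\<Sum>i\<le>m. s (monom 1 i))"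
  show "0 < ?C" using nonneg by (simp add: add_pos_nonneg sum_nonneg)
  fix g :: "complex poly" assume g: "degree g \<le> m"
  have "s (monom 1 i) \<le> ?C" if "i \<le> m" for i
    using member_le_sum[of i "{..m}" "\<lambda>i. s (monom 1 i)"] that nonneg by simp
  then have "(\<Sum>i\<le>m. cmod (coeff g i) * s (monom 1 i)) \<le> (\<Sum>i\<le>m. cmod (coeff g i) * ?C)"
    by (intro sum_mono mult_left_mono) auto
  also have "\<dots> = ?C * wnorm 1 g"
    by (simp add: wnorm_alt[OF g] sum_distrib_right mult.commute[of ?C])
  finally show "s g \<le> ?C * wnorm 1 g" using le_sum_coeff[OF g] by simp
qed

end

text \<open>\<open>pCons 0 (g * h)\<close> is \<open>z g h\<close>, the product of the algebra
  written in terms of polynomials.\<close>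

locale poly_alg_seminorm = poly_seminorm +
  assumes mult_le: "s (pCons 0 (g * h)) \<le> s g * s h"

lemma poly_seminorm_wnorm: "0 \<le> d \<Longrightarrow> poly_seminorm (wnorm d)"
  by unfold_locales (simp_all only: wnorm_add_le wnorm_scale)

lemma wnorm_star_monom:
  assumes "0 \<le> d"
  shows "wnorm d (pCons 0 (monom 1 l * h)) \<le> d ^ Suc l * wnorm d h"
proof -
  have *: "pCons 0 (monom 1 l * h) = monom 1 (Suc l) * h"
    by (simp add: monom_Suc)
  have **: "(\<Sum>i\<le>degree h. monom (coeff h i) i) = h" by (rule poly_as_sum_of_monoms)
  interpret poly_seminorm "wnorm d" by (rule poly_seminorm_wnorm[OF assms])
  have "pCons 0 (monom 1 l * h) = (\<Sum>i\<le>degree h. monom (coeff h i) (Suc l + i))"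
    unfolding * by (subst **[symmetric]) (simp only: sum_distrib_left mult_monom mult_1)
  then have "wnorm d (pCons 0 (monom 1 l * h)) \<le> (\<Sum>i\<le>degree h. wnorm d (monom (coeff h i) (Suc l + i)))"
    by (simp only: sum_le)
  also have "\<dots> = (\<Sum>i\<le>degree h. d ^ Suc l * (cmod (coeff h i) * d ^ Suc i))"
    unfolding wnorm_monom by (simp add: power_add mult_ac)
  also have "\<dots> = d ^ Suc l * wnorm d h"
    unfolding wnorm_def sum_distrib_left ..
  finally show ?thesis .
qed

lemma wnorm_star_le:
  assumes "0 \<le> d"
  shows "wnorm d (pCons 0 (g * h)) \<le> wnorm d g * wnorm d h"
proof -
  interpret W: poly_seminorm "wnorm d" by (rule poly_seminorm_wnorm[OF assms])
  have **: "(\<Sum>i\<le>degree g. monom (coeff g i) i) = g" by (rule poly_as_sum_of_monoms)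
  have "pCons 0 (g * h) = monom 1 1 * (\<Sum>i\<le>degree g. monom (coeff g i) i) * h"
    unfolding ** by (simp add: monom_altdef)
  also have "\<dots> = (\<Sum>i\<le>degree g. monom (coeff g i) (Suc i) * h)"
    by (simp add: sum_distrib_left sum_distrib_right mult_monom)
  also have "\<dots> = (\<Sum>i\<le>degree g. [:coeff g i:] * pCons 0 (monom 1 i * h))"
    by (intro sum.cong refl) (simp add: monom_altdef)
  finally have "wnorm d (pCons 0 (g * h))
      \<le> (\<Sum>i\<le>degree g. wnorm d ([:coeff g i:] * pCons 0 (monom 1 i * h)))"
    by (simp only: W.sum_le)
  also have "\<dots> \<le> (\<Sum>i\<le>degree g. cmod (coeff g i) * (d ^ Suc i * wnorm d h))"
    unfolding W.scale by (intro sum_mono mult_left_mono wnorm_star_monom assms) auto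
  also have "\<dots> = wnorm d g * wnorm d h"
    by (simp add: wnorm_def sum_distrib_right mult.assoc)
  finally show ?thesis .
qed

lemma wnorm_split_top:
  assumes "degree r \<le> m"
  shows "wnorm d (r - monom (coeff r m) m) + cmod (coeff r m) * d ^ Suc m = wnorm d r"
proof -
  have deg: "degree (r - monom (coeff r m) m) \<le> m"
    using assms by (intro degree_diff_le) (auto simp: degree_monom_le)
  have "wnorm d (r - monom (coeff r m) m)
      = (\<Sum>i\<in>{..m} - {m}. cmod (coeff (r - monom (coeff r m) m) i) * d ^ Suc i)"
    unfolding wnorm_alt[OF deg] by (intro sum.mono_neutral_right) auto
  also have "\<dots> = (\<Sum>i\<in>{..m} - {m}. cmod (coeff r i) * d ^ Suc i)"
    by (intro sum.cong) auto
  moreover have "wnorm d r = cmod (coeff r m) * d ^ Suc m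
      + (\<Sum>i\<in>{..m} - {m}. cmod (coeff r i) * d ^ Suc i)"
    unfolding wnorm_alt[OF assms] by (rule sum.remove) auto
  ultimately show ?thesis by simp
qed

lemma degree_less_SucI:
  fixes p :: "complex poly"
  shows "degree p \<le> Suc m \<Longrightarrow> coeff p (Suc m) = 0 \<Longrightarrow> degree p \<le> m"
  using eq_zero_or_degree_less[of p "Suc m"] by auto

subsection \<open>Reduction modulo a polynomial near a power\<close>

text \<open>\<open>\<rho> ^ Suc (Suc m)\<close> is the norm of \<open>monom 1 (Suc m)\<close>. So
  replacing that monomial by its remainder modulo \<open>P\<close>, which is
  \<open>monom 1 (Suc m) - P\<close>, does not increase \<open>wnorm \<rho>\<close>.\<close>

definition near_power :: "real \<Rightarrow> nat \<Rightarrow> complex poly \<Rightarrow> bool" where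
  "near_power \<rho> m P \<longleftrightarrow> degree P = Suc m \<and> coeff P (Suc m) = 1
     \<and> wnorm \<rho> (P - monom 1 (Suc m)) \<le> \<rho> ^ Suc (Suc m)"

lemma degree_mod_le:
  fixes P :: "complex poly"
  assumes "degree P = Suc m"
  shows "degree (g mod P) \<le> m"
  using degree_mod_less[of P g] assms by (cases "P = 0") auto

text \<open>Pass from \<open>l\<close> to \<open>l + 1\<close> by multiplying the remainder by
  \<open>z\<close>. Only its top term can leave the reduced range, and trading it for a multiple of
  \<open>monom 1 (Suc m) - P\<close> costs no more norm than the term carried.\<close>

lemma wnorm_monom_mod_le:
  assumes \<rho>: "0 < \<rho>" and P: "near_power \<rho> m P"
  shows "wnorm \<rho> (monom 1 l mod P) \<le> \<rho> ^ Suc l"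
proof (induction l)
  case 0
  then show ?case
    using P \<rho> by (subst mod_poly_less) (auto simp: near_power_def wnorm_one)
next
  case (Suc l)
  interpret W: poly_seminorm "wnorm \<rho>" using \<rho> by (intro poly_seminorm_wnorm) simp
  define r where "r = monom 1 l mod P"
  define c where "c = coeff r m"
  define r' where "r' = r - monom c m"
  have P1: "degree P = Suc m" "coeff P (Suc m) = 1" using P by (auto simp: near_power_def)
  have degr: "degree r \<le> m" unfolding r_def using P1 by (intro degree_mod_le)
  have "monom 1 (Suc l) mod P = ([:0, 1:] * monom 1 l) mod P"
    by (simp add: monom_Suc)
  also have "\<dots> = ([:0, 1:] * r) mod P" unfolding r_def by (simp only: mod_mult_right_eq)
  \<comment> \<open>Since \<open>P\<close> is monic, subtracting \<open>c P\<close> cancels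
    coefficient \<open>m + 1\<close> of \<open>z r\<close>, and what is left is already
    reduced.\<close>
  also have "\<dots> = ([:0, 1:] * r - [:c:] * P) mod P" by (simp add: poly_mod_diff_left mod_smult_left)
  also have "\<dots> = [:0, 1:] * r - [:c:] * P"
  proof (rule mod_poly_less)
    have "degree ([:0, 1:] * r - [:c:] * P) \<le> m"
    proof (rule degree_less_SucI)
      show "degree ([:0, 1:] * r - [:c:] * P) \<le> Suc m"
        using degr P1 degree_pCons_le[of 0 r] degree_smult_le[of c P]
        by (intro degree_diff_le) (auto intro: order_trans)
      show "coeff ([:0, 1:] * r - [:c:] * P) (Suc m) = 0" using P1 by (simp add: c_def)
    qed
    then show "degree ([:0, 1:] * r - [:c:] * P) < degree P" using P1 by simp
  qed
  also have "\<dots> = pCons 0 (1 * r') - [:c:] * (P - monom 1 (Suc m))"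
    by (simp add: r'_def monom_Suc smult_diff_right smult_monom)
  finally have "wnorm \<rho> (monom 1 (Suc l) mod P)
      \<le> wnorm \<rho> (pCons 0 (1 * r')) + cmod c * wnorm \<rho> (P - monom 1 (Suc m))"
    using W.diff_le W.scale by metis
  also have "\<dots> \<le> \<rho> * wnorm \<rho> r' + cmod c * \<rho> ^ Suc (Suc m)"
  proof (intro add_mono mult_left_mono)
    show "wnorm \<rho> (pCons 0 (1 * r')) \<le> \<rho> * wnorm \<rho> r'"
      using wnorm_star_le[of \<rho> 1 r'] \<rho> by (simp add: wnorm_one)
  qed (use P in \<open>auto simp: near_power_def\<close>)
  also have "\<dots> = \<rho> * (wnorm \<rho> r' + cmod c * \<rho> ^ Suc m)" by (simp add: algebra_simps)
  also have "wnorm \<rho> r' + cmod c * \<rho> ^ Suc m = wnorm \<rho> r"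
    unfolding r'_def c_def by (rule wnorm_split_top[OF degr])
  also have "\<rho> * wnorm \<rho> r \<le> \<rho> * \<rho> ^ Suc l" using Suc \<rho> unfolding r_def by (intro mult_left_mono) auto
  finally show ?case by simp
qed

text \<open>Dividing the weighted estimate by the weight bounds coefficient \<open>i\<close> of the
  remainder by \<open>\<rho> ^ (l - i)\<close>, and there are \<open>m + 1\<close> coefficients.
  This is the sense in which reduction almost kills high powers, uniformly in
  \<open>P\<close>.\<close>

lemma wnorm_1_monom_mod_le:
  fixes \<rho> :: real
  assumes \<rho>: "0 < \<rho>" "\<rho> \<le> 1" and P: "near_power \<rho> m P" and l: "m \<le> l"
  shows "wnorm 1 (monom 1 l mod P) \<le> Suc m * \<rho> ^ (l - m)"
proof -
  define r where "r = monom 1 l mod P"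
  have degr: "degree r \<le> m"
    unfolding r_def using P by (intro degree_mod_le) (auto simp: near_power_def)
  have "cmod (coeff r i) \<le> \<rho> ^ (l - m)" if i: "i \<le> m" for i
  proof -
    have "cmod (coeff r i) * \<rho> ^ Suc i \<le> wnorm \<rho> r"
      unfolding wnorm_alt[OF degr] using i \<rho>
      by (intro member_le_sum[of i "{..m}" "\<lambda>i. cmod (coeff r i) * \<rho> ^ Suc i"]) auto
    also have "\<dots> \<le> \<rho> ^ Suc l" unfolding r_def by (rule wnorm_monom_mod_le) fact+
    also have "\<dots> = \<rho> ^ (l - i) * \<rho> ^ Suc i" using i l by (simp flip: power_add)
    finally have "cmod (coeff r i) \<le> \<rho> ^ (l - i)" using \<rho> by simp
    also have "\<dots> \<le> \<rho> ^ (l - m)" using \<rho> i by (intro power_decreasing) auto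
    finally show ?thesis .
  qed
  then have "(\<Sum>i\<le>m. cmod (coeff r i) * 1 ^ Suc i) \<le> (\<Sum>i\<le>m. \<rho> ^ (l - m))"
    by (intro sum_mono) auto
  then show ?thesis unfolding r_def[symmetric] wnorm_alt[OF degr] by simp
qed

section \<open>Extending a seminorm through the quotient by \<open>P\<close>\<close>

definition radius_below :: "(complex poly \<Rightarrow> real) \<Rightarrow> real \<Rightarrow> bool" where
  "radius_below s d \<longleftrightarrow> (\<forall>\<^sub>F l in sequentially. s (monom 1 l) \<le> d ^ Suc l / 2)"

definition extend :: "(complex poly \<Rightarrow> real) \<Rightarrow> real \<Rightarrow> complex poly \<Rightarrow> complex poly \<Rightarrow> real" where
  "extend s d P g = s (g mod P) + wnorm d (g mod P)"

lemma poly_seminorm_add_wnorm: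
  assumes "poly_seminorm s" "0 \<le> d"
  shows "poly_seminorm (\<lambda>g. s g + wnorm d g)"
proof -
  interpret poly_seminorm s by fact
  interpret W: poly_seminorm "wnorm d" by (rule poly_seminorm_wnorm) fact
  show ?thesis
  proof
    fix g h c
    show "s (g + h) + wnorm d (g + h) \<le> s g + wnorm d g + (s h + wnorm d h)"
      using add_le[of g h] W.add_le[of g h] by linarith
    show "s ([:c:] * g) + wnorm d ([:c:] * g) = cmod c * (s g + wnorm d g)"
      by (simp only: scale W.scale distrib_left)
  qed
qed

lemma poly_seminorm_extend:
  assumes "poly_seminorm s" "0 \<le> d"
  shows "poly_seminorm (extend s d P)"
proof -
  interpret N: poly_seminorm "\<lambda>g. s g + wnorm d g" by (rule poly_seminorm_add_wnorm) fact+
  show ?thesis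
  proof
    fix g h c
    show "extend s d P (g + h) \<le> extend s d P g + extend s d P h"
      using N.add_le[of "g mod P" "h mod P"] by (simp add: extend_def poly_mod_add_left)
    show "extend s d P ([:c:] * g) = cmod c * extend s d P g"
      using N.scale[of c "g mod P"] by (simp add: extend_def mod_smult_left)
  qed
qed

text \<open>For reduced factors \<open>g'\<close>, \<open>h'\<close> put \<open>u = z g' h'\<close>.
  Replacing \<open>u\<close> by its remainder changes \<open>s\<close> by at most
  \<open>s (u - u mod P)\<close>. This error together with the new weighted term is at most
  \<open>wnorm d u\<close>, hence at most \<open>wnorm d g' * wnorm d h'\<close>. Adding
  \<open>s u \<le> s g' * s h'\<close> stays below the product of the two sums, because the cross
  terms are nonnegative.\<close>

lemma poly_alg_seminorm_extend:
  assumes "poly_alg_seminorm s" and d: "0 < d" "d \<le> 1" and P: "degree P = Suc m"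
    and low: "\<And>l. m < l \<Longrightarrow> s (monom 1 l) \<le> d ^ Suc l / 2"
    and small: "\<And>l. m < l \<Longrightarrow> l \<le> 2 * m + 1 \<Longrightarrow> extend s d P (monom 1 l) \<le> d ^ Suc l / 2"
  shows "poly_alg_seminorm (extend s d P)"
proof -
  interpret poly_alg_seminorm s by fact
  interpret W: poly_seminorm "wnorm d" using d by (intro poly_seminorm_wnorm) simp
  have E: "poly_seminorm (extend s d P)" using d by (intro poly_seminorm_extend poly_seminorm_axioms) simp
  \<comment> \<open>\<open>N\<close> is chosen so that the extended seminorm of \<open>u\<close> is
    at most \<open>s u + N u\<close>, and so that it is itself a seminorm, which reduces its
    estimate to monomials.\<close>
  define N where "N u = s (u - u mod P) + wnorm d (u mod P)" for u
  interpret N: poly_seminorm N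
  proof
    fix g h :: "complex poly" and c
    show "N (g + h) \<le> N g + N h"
      using add_le[of "g - g mod P" "h - h mod P"] W.add_le[of "g mod P" "h mod P"]
      by (simp add: N_def poly_mod_add_left algebra_simps)
    have "[:c:] * g - ([:c:] * g) mod P = [:c:] * (g - g mod P)"
      by (simp add: mod_smult_left smult_diff_right)
    moreover have "([:c:] * g) mod P = [:c:] * (g mod P)" by (simp add: mod_smult_left)
    ultimately show "N ([:c:] * g) = cmod c * N g"
      unfolding N_def by (simp only: scale W.scale distrib_left)
  qed
  have N_monom: "N (monom 1 l) \<le> d ^ Suc l" if l: "l \<le> 2 * m + 1" for l
  proof (cases "l \<le> m")
    case True
    then have "monom 1 l mod P = monom 1 l"
      using P by (intro mod_poly_less) (simp add: degree_monom_eq)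
    then show ?thesis by (simp add: N_def zero wnorm_monom)
  next
    case False
    \<comment> \<open>The halves in \<open>low\<close> and \<open>small\<close> are there to be
      added: one bounds \<open>s\<close> of the monomial, the other both terms coming from its
      remainder.\<close>
    then have "N (monom 1 l) \<le> s (monom 1 l) + extend s d P (monom 1 l)"
      unfolding N_def extend_def using diff_le[of "monom 1 l" "monom 1 l mod P"] by linarith
    with small[of l] low[of l] False l show ?thesis by linarith
  qed
  have "extend s d P (pCons 0 (g * h)) \<le> extend s d P g * extend s d P h" for g h
  proof -
    define g' h' where "g' = g mod P" and "h' = h mod P"
    define u where "u = pCons 0 (g' * h')"
    have deg: "degree g' \<le> m" "degree h' \<le> m"
      unfolding g'_def h'_def using P by (auto intro!: degree_mod_le)
    have "pCons 0 (g * h) mod P = ([:0, 1:] * (g * h)) mod P" by simp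
    also have "\<dots> = ([:0, 1:] * (g' * h')) mod P"
      unfolding g'_def h'_def by (metis mod_mult_eq mod_mult_right_eq)
    finally have "pCons 0 (g * h) mod P = u mod P" by (simp add: u_def)
    then have "extend s d P (pCons 0 (g * h)) = s (u mod P) + wnorm d (u mod P)"
      by (simp add: extend_def)
    also have "\<dots> \<le> s u + N u"
      unfolding N_def using diff_le[of u "u - u mod P"] by simp
    also have "\<dots> \<le> s g' * s h' + wnorm d g' * wnorm d h'"
    proof (rule add_mono)
      show "s u \<le> s g' * s h'" unfolding u_def by (rule mult_le)
      \<comment> \<open>A product of reduced factors has degree at most \<open>2 * m + 1\<close>,
        which is why \<open>small\<close> stops there.\<close>
      have "degree u \<le> Suc (degree (g' * h'))" unfolding u_def by (rule degree_pCons_le)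
      also have "degree (g' * h') \<le> m + m"
        using degree_mult_le[of g' h'] deg by linarith
      finally have "N u \<le> wnorm d u" by (intro N.le_wnorm N_monom) simp
      also have "\<dots> \<le> wnorm d g' * wnorm d h'"
        unfolding u_def using d by (intro wnorm_star_le) simp
      finally show "N u \<le> wnorm d g' * wnorm d h'" .
    qed
    also have "\<dots> \<le> (s g' + wnorm d g') * (s h' + wnorm d h')"
      using nonneg[of g'] nonneg[of h'] W.nonneg[of g'] W.nonneg[of h'] by (simp add: algebra_simps)
    finally show ?thesis by (simp add: extend_def g'_def h'_def)
  qed
  with E show ?thesis by (simp add: poly_alg_seminorm_def poly_alg_seminorm_axioms_def)
qed

text \<open>The threshold depends on \<open>s\<close>, \<open>d\<close> and \<open>m\<close> but not
  on \<open>P\<close>, so \<open>P\<close> can be fitted to the target afterwards. Everything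
  follows from one bound \<open>K * \<rho> ^ (l - m)\<close> on the extended seminorm of
  \<open>monom 1 l\<close>.\<close>

lemma extend_near_power:
  assumes "poly_alg_seminorm s" and d: "0 < d" "d \<le> 1"
    and low: "\<And>l. m < l \<Longrightarrow> s (monom 1 l) \<le> d ^ Suc l / 2"
  shows "\<exists>\<rho>0>0. \<forall>\<rho> P. 0 < \<rho> \<and> \<rho> \<le> \<rho>0 \<and> near_power \<rho> m P \<longrightarrow>
           poly_alg_seminorm (extend s d P) \<and> radius_below (extend s d P) (2 * \<rho>)"
proof -
  interpret poly_alg_seminorm s by fact
  interpret N: poly_seminorm "\<lambda>g. s g + wnorm d g"
    using d by (intro poly_seminorm_add_wnorm poly_seminorm_axioms) simp
  obtain C where C: "0 < C" "\<And>g. degree g \<le> m \<Longrightarrow> s g + wnorm d g \<le> C * wnorm 1 g"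
    using N.le_const_wnorm by metis
  define K where "K = C * Suc m"
  have K: "0 < K" using C by (simp add: K_def)
  \<comment> \<open>For \<open>m < l\<close> at least one factor \<open>\<rho>\<close> is present.
    As \<open>d \<le> 1\<close>, the strictest of the finitely many requirements is the one for
    \<open>l = 2 * m + 1\<close>.\<close>
  define \<rho>0 where "\<rho>0 = min 1 (d ^ (2 * m + 2) / (2 * K))"
  have bound: "extend s d P (monom 1 l) \<le> K * \<rho> ^ (l - m)"
    if "0 < \<rho>" "\<rho> \<le> \<rho>0" "near_power \<rho> m P" "m \<le> l" for \<rho> P l
  proof -
    have "extend s d P (monom 1 l) \<le> C * wnorm 1 (monom 1 l mod P)"
      unfolding extend_def using that by (intro C degree_mod_le) (auto simp: near_power_def)
    also have "\<dots> \<le> C * (Suc m * \<rho> ^ (l - m))"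
      using that C by (intro mult_left_mono wnorm_1_monom_mod_le) (auto simp: \<rho>0_def)
    finally show ?thesis by (simp add: K_def mult_ac)
  qed
  show ?thesis
  proof (intro exI[of _ \<rho>0] conjI allI impI)
    show "\<rho>0 > 0" using d K by (simp add: \<rho>0_def)
    fix \<rho> P assume *: "0 < \<rho> \<and> \<rho> \<le> \<rho>0 \<and> near_power \<rho> m P"
    then have \<rho>: "0 < \<rho>" "\<rho> \<le> 1" "K * \<rho> \<le> d ^ (2 * m + 2) / 2"
      using K by (auto simp: \<rho>0_def field_simps)
    show "poly_alg_seminorm (extend s d P)"
    proof (rule poly_alg_seminorm_extend[OF assms(1) d])
      fix l assume l: "m < l" "l \<le> 2 * m + 1"
      have "extend s d P (monom 1 l) \<le> K * \<rho> ^ (l - m)" using * l by (intro bound) auto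
      also have "\<dots> \<le> K * \<rho> ^ 1"
        using \<rho> K l by (intro mult_left_mono power_decreasing) auto
      also have "\<dots> \<le> d ^ (2 * m + 2) / 2" using \<rho> by simp
      also have "\<dots> \<le> d ^ Suc l / 2"
        using d l by (intro divide_right_mono power_decreasing) auto
      finally show "extend s d P (monom 1 l) \<le> d ^ Suc l / 2" .
    qed (use * low in \<open>auto simp: near_power_def\<close>)
    \<comment> \<open>Doubling the radius to \<open>2 * \<rho>\<close> gains a factor
      \<open>2 ^ l\<close>, which eventually beats the constant
      \<open>K / \<rho> ^ Suc m\<close>.\<close>
    have "(\<lambda>l. (1/2) ^ l) \<longlonglongrightarrow> (0::real)" by (rule LIMSEQ_power_zero) simp
    moreover have "0 < \<rho> ^ Suc m / K" using \<rho> K by simp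
    ultimately have "\<forall>\<^sub>F l in sequentially. (1/2) ^ l < \<rho> ^ Suc m / K"
      by (rule order_tendstoD)
    then show "radius_below (extend s d P) (2 * \<rho>)"
      unfolding radius_below_def using eventually_ge_at_top[of m]
    proof eventually_elim
      case (elim l)
      have "extend s d P (monom 1 l) \<le> K * \<rho> ^ (l - m)" using * elim by (intro bound) auto
      also have "\<dots> \<le> 2 ^ l * \<rho> ^ Suc m * \<rho> ^ (l - m)"
        using elim K \<rho> by (intro mult_right_mono) (auto simp: field_simps power_divide)
      also have "\<dots> = (2 * \<rho>) ^ Suc l / 2"
        using elim by (simp add: power_mult_distrib mult_ac flip: power_add)
      finally show ?case .
    qed
  qed
qed

subsection \<open>Polynomials near a power dividing a difference\<close>

text \<open>
  With \<open>z = exp (w / n) - 1\<close> the equation \<open>(1 + z) ^ n = q(z)\<close> becomes a fixed point equation for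
  \<open>w\<close> near each logarithm of \<open>q(0)\<close>, to which Brouwer's theorem applies.
\<close>

lemma many_small_roots:
  fixes q :: "complex poly"
  assumes q0: "poly q 0 \<noteq> 0"
  obtains R where "0 < R"
    "\<forall>\<^sub>F n in sequentially. \<exists>Z. finite Z \<and> card Z = L \<and> (\<forall>z\<in>Z. cmod z \<le> R / n \<and> (1 + z) ^ n = poly q z)"
proof -
  \<comment> \<open>With \<open>x = w / n\<close> the equation reads
    \<open>exp w = poly q 0 * f x\<close>. Since \<open>f\<close> is close to 1 near 0, it follows
    from \<open>w = Ln (poly q 0) + 2 \<pi> i k + Ln (f x)\<close> with the principal
    logarithm.\<close>
  define f where "f x = poly q (exp x - 1) / poly q 0" for x
  have f_cont: "continuous_on UNIV f" unfolding f_def using q0 by (intro continuous_intros) auto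
  have f0: "f 0 = 1" using q0 by (simp add: f_def)
  have "isCont f 0" using f_cont by (simp add: continuous_on_eq_continuous_at)
  then have "f \<midarrow>0\<rightarrow> 1" by (simp add: isCont_def f0)
  then have "\<forall>\<^sub>F x in at 0. dist (f x) 1 < 1" by (rule tendstoD) simp
  then obtain r1 where r1: "r1 > 0" "\<And>x. x \<noteq> 0 \<Longrightarrow> dist x 0 < r1 \<Longrightarrow> dist (f x) 1 < 1"
    unfolding eventually_at by auto
  have "isCont (\<lambda>x. Ln (f x)) 0"
    using \<open>isCont f 0\<close> by (intro isCont_Ln') (auto simp: f0)
  then have "(\<lambda>x. Ln (f x)) \<midarrow>0\<rightarrow> 0" by (simp add: isCont_def f0)
  then have "\<forall>\<^sub>F x in at 0. dist (Ln (f x)) 0 < 1" by (rule tendstoD) simp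
  then obtain r2 where r2: "r2 > 0" "\<And>x. x \<noteq> 0 \<Longrightarrow> dist x 0 < r2 \<Longrightarrow> dist (Ln (f x)) 0 < 1"
    unfolding eventually_at by auto
  have "(\<lambda>x::complex. (exp x - 1) / x) \<midarrow>0\<rightarrow> 1"
    using DERIV_exp[of "0::complex"] by (simp add: DERIV_def)
  then have "\<forall>\<^sub>F x in at 0. dist ((exp x - 1) / x) (1::complex) < 1" by (rule tendstoD) simp
  then obtain r3 where r3: "r3 > 0"
      "\<And>x::complex. x \<noteq> 0 \<Longrightarrow> dist x 0 < r3 \<Longrightarrow> dist ((exp x - 1) / x) 1 < 1"
    unfolding eventually_at by auto
  \<comment> \<open>Within this radius \<open>Ln (f x)\<close> is continuous and smaller than 1, and
    \<open>exp x - 1\<close> is at most twice \<open>x\<close>. The cap 1 controls imaginary parts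
    when the roots are shown to be distinct.\<close>
  define r where "r = min 1 (min r1 (min r2 r3))"
  have r: "0 < r" "r \<le> 1" using r1 r2 r3 by (auto simp: r_def)
  have exp_near: "cmod (exp x - 1) \<le> 2 * cmod x" if "cmod x < r" for x
  proof (cases "x = 0")
    case False
    then have "cmod ((exp x - 1) / x - 1) < 1" using r3(2)[of x] that by (simp add: r_def dist_norm)
    then have "cmod ((exp x - 1) / x) \<le> 2"
      using norm_triangle_ineq2[of "(exp x - 1) / x" 1] by simp
    then show ?thesis using False by (simp add: norm_divide field_simps)
  qed simp
  have f_near: "cmod (f x - 1) < 1" "cmod (Ln (f x)) < 1" if "cmod x < r" for x
    using r1(2)[of x] r2(2)[of x] that by (cases "x = 0"; auto simp: r_def f0 dist_norm)+
  have f_nonneg: "f x \<notin> \<real>\<^sub>\<le>\<^sub>0" if "cmod x < r" for x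
  proof
    assume "f x \<in> \<real>\<^sub>\<le>\<^sub>0"
    then have "Re (f x) \<le> 0" by (auto simp: complex_nonpos_Reals_iff)
    then show False using f_near(1)[OF that] abs_Re_le_cmod[of "f x - 1"] by simp
  qed
  define w where "w k = Ln (poly q 0) + 2 * of_real pi * \<i> * of_nat k" for k :: nat
  define B where "B = cmod (Ln (poly q 0)) + 2 * pi * L + 1"
  have B: "0 < B" unfolding B_def by (simp add: add_nonneg_pos)
  have w_bound: "cmod v \<le> B" if "v \<in> cball (w k) 1" "k < L" for v k
  proof -
    have "cmod v \<le> cmod (w k) + 1"
      using that norm_triangle_ineq2[of v "w k"] by (simp add: dist_norm norm_minus_commute)
    also have "cmod (w k) \<le> cmod (Ln (poly q 0)) + cmod (2 * of_real pi * \<i> * of_nat k)"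
      unfolding w_def by (rule norm_triangle_ineq)
    also have "cmod (2 * of_real pi * \<i> * of_nat k) = 2 * pi * k"
      by (simp add: norm_mult)
    also have "2 * pi * k \<le> 2 * pi * L" using that by simp
    finally show ?thesis by (simp add: B_def)
  qed
  have "\<exists>Z. finite Z \<and> card Z = L \<and> (\<forall>z\<in>Z. cmod z \<le> (2 * B) / n \<and> (1 + z) ^ n = poly q z)"
    if n: "B / r < real n" for n
  proof -
    have n0: "0 < real n" using n B r by (smt (verit) divide_pos_pos)
    have Bn: "B / n < r" using n n0 r by (simp add: field_simps)
    have small: "cmod (v / n) < r" if "v \<in> cball (w k) 1" "k < L" for v k
    proof -
      have "cmod (v / n) \<le> B / n" using w_bound[OF that] n0 by (simp add: norm_divide divide_right_mono)
      then show ?thesis using Bn by simp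
    qed
    \<comment> \<open>The map moves the centre \<open>w k\<close> by a logarithm of modulus below 1,
      so it sends the closed unit ball around \<open>w k\<close> into itself.\<close>
    have "\<exists>v. v \<in> cball (w k) 1 \<and> w k + Ln (f (v / n)) = v" if k: "k < L" for k
    proof (rule brouwer_ball[of 1 "w k" "\<lambda>v. w k + Ln (f (v / n))"])
      show "continuous_on (cball (w k) 1) (\<lambda>v. w k + Ln (f (v / n)))"
        using small[OF _ k] f_nonneg n0
        by (intro continuous_intros continuous_on_compose2[OF f_cont]) auto
      show "(\<lambda>v. w k + Ln (f (v / n))) \<in> cball (w k) 1 \<rightarrow> cball (w k) 1"
        using f_near(2)[OF small[OF _ k]] by (force simp: dist_norm)
    qed auto
    then obtain v where v: "\<And>k. k < L \<Longrightarrow> v k \<in> cball (w k) 1"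
        "\<And>k. k < L \<Longrightarrow> w k + Ln (f (v k / n)) = v k"
      by metis
    define z where "z k = exp (v k / n) - 1" for k
    have z_root: "(1 + z k) ^ n = poly q (z k)" if k: "k < L" for k
    proof -
      have nz: "f (v k / n) \<noteq> 0" using f_nonneg[OF small[OF v(1)[OF k] k]] by auto
      have "(1 + z k) ^ n = exp (v k)"
        using n0 by (simp add: z_def flip: exp_of_nat_mult)
      also have "\<dots> = exp (w k) * exp (Ln (f (v k / n)))" using v(2)[OF k] by (metis exp_add)
      also have "exp (w k) = poly q 0"
        using exp_integer_2pi[of "of_nat k"] q0 by (simp add: w_def exp_add mult_ac)
      finally show ?thesis using nz q0 by (simp add: f_def z_def)
    qed
    have z_small: "cmod (z k) \<le> (2 * B) / n" if k: "k < L" for k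
    proof -
      have "cmod (z k) \<le> 2 * cmod (v k / n)"
        unfolding z_def using small[OF v(1)[OF k] k] by (rule exp_near)
      also have "\<dots> \<le> 2 * (B / n)"
        using w_bound[OF v(1)[OF k] k] n0 by (simp add: norm_divide divide_right_mono)
      finally show ?thesis by simp
    qed
    \<comment> \<open>Equal roots force \<open>v j = v k\<close>, since the exponents have small
      imaginary parts. Then the centres are within distance 2, whereas distinct ones are at least
      \<open>2 * pi\<close> apart.\<close>
    have "inj_on z {..<L}"
    proof (rule inj_onI)
      fix j k assume jk: "j \<in> {..<L}" "k \<in> {..<L}" and eq: "z j = z k"
      have Im_small: "\<bar>Im (v i / n)\<bar> < 1" if "i < L" for i
        using abs_Im_le_cmod[of "v i / n"] small[OF v(1)[OF that] that] r by linarith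
      have "\<bar>Im (v j / n) - Im (v k / n)\<bar> < 2 * pi"
        using Im_small[of j] Im_small[of k] jk pi_ge_two unfolding lessThan_iff by linarith
      moreover have "exp (v j / n) = exp (v k / n)" using eq by (simp add: z_def)
      ultimately have "v j / n = v k / n" by (rule exp_complex_eqI)
      then have "v j = v k" using n0 by simp
      then have "dist (w j) (w k) \<le> 2"
        using v(1)[of j] v(1)[of k] jk dist_triangle2[of "w j" "w k" "v j"] by (auto simp: dist_commute)
      moreover have "w j - w k = 2 * of_real pi * \<i> * of_int (int j - int k)"
        by (simp add: w_def algebra_simps)
      then have "dist (w j) (w k) = 2 * pi * \<bar>int j - int k\<bar>"
        by (simp add: dist_norm norm_mult del: of_int_diff)
      ultimately have "2 * pi * \<bar>int j - int k\<bar> \<le> 2" by simp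
      show "j = k"
      proof (rule ccontr)
        assume "j \<noteq> k"
        then have "1 \<le> real_of_int \<bar>int j - int k\<bar>" by linarith
        then have "2 * pi * 1 \<le> 2 * pi * real_of_int \<bar>int j - int k\<bar>" by (intro mult_left_mono) auto
        with \<open>2 * pi * \<bar>int j - int k\<bar> \<le> 2\<close> pi_ge_two show False by linarith
      qed
    qed
    then have "finite (z ` {..<L}) \<and> card (z ` {..<L}) = L
        \<and> (\<forall>x\<in>z ` {..<L}. cmod x \<le> (2 * B) / n \<and> (1 + x) ^ n = poly q x)"
      using z_root z_small by (auto simp: card_image)
    then show ?thesis by blast
  qed
  moreover have "\<forall>\<^sub>F n in sequentially. B / r < real n"
    using filterlim_at_top_dense[of real sequentially] filterlim_real_sequentially by auto
  ultimately have "\<forall>\<^sub>F n in sequentially. \<exists>Z. finite Z \<and> card Z = L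
      \<and> (\<forall>z\<in>Z. cmod z \<le> (2 * B) / n \<and> (1 + z) ^ n = poly q z)"
    by (rule eventually_mono[rotated])
  then show ?thesis using B by (intro that[of "2 * B"]) auto
qed

section \<open>Explicit divisors for monomials and for powers of \<open>1 + z\<close>\<close>

lemma wnorm_pCons_le: "0 \<le> d \<Longrightarrow> wnorm d (pCons 0 g) \<le> d * wnorm d g"
  using wnorm_star_le[of d 1 g] by (simp add: wnorm_one)

text \<open>The bound is the norm of \<open>(z + r) ^ m - z ^ m\<close> for
  \<open>m = card Z\<close>, the worst case, in which every root is \<open>- r\<close>.\<close>

lemma wnorm_prod_linear:
  assumes \<rho>: "0 \<le> \<rho>" and "finite Z" "\<And>z. z \<in> Z \<Longrightarrow> cmod z \<le> r"
  shows "wnorm \<rho> ((\<Prod>z\<in>Z. [:- z, 1:]) - monom 1 (card Z)) \<le> \<rho> * ((\<rho> + r) ^ card Z - \<rho> ^ card Z)"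
  using assms(2,3)
proof (induction Z)
  case empty
  then show ?case by (simp add: wnorm_def)
next
  case (insert z Z)
  interpret W: poly_seminorm "wnorm \<rho>" by (rule poly_seminorm_wnorm) fact
  define P where "P = (\<Prod>z\<in>Z. [:- z, 1:])"
  define m where "m = card Z"
  have IH: "wnorm \<rho> (P - monom 1 m) \<le> \<rho> * ((\<rho> + r) ^ m - \<rho> ^ m)"
    using insert by (simp add: P_def m_def)
  have r: "cmod z \<le> r" "0 \<le> r" using insert.prems[of z] by (auto intro: order_trans[OF norm_ge_zero])
  have "wnorm \<rho> P \<le> wnorm \<rho> (P - monom 1 m) + wnorm \<rho> (monom 1 m)"
    using W.add_le[of "P - monom 1 m" "monom 1 m"] by simp
  also have "\<dots> \<le> \<rho> * (\<rho> + r) ^ m" using IH by (simp add: wnorm_monom algebra_simps)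
  finally have nP: "wnorm \<rho> P \<le> \<rho> * (\<rho> + r) ^ m" .
  have "(\<Prod>z\<in>insert z Z. [:- z, 1:]) - monom 1 (card (insert z Z))
      = pCons 0 (P - monom 1 m) - [:z:] * P"
    using insert by (simp add: P_def m_def monom_Suc)
  then have "wnorm \<rho> ((\<Prod>z\<in>insert z Z. [:- z, 1:]) - monom 1 (card (insert z Z)))
      \<le> wnorm \<rho> (pCons 0 (P - monom 1 m)) + cmod z * wnorm \<rho> P"
    using W.diff_le W.scale by metis
  also have "\<dots> \<le> \<rho> * (\<rho> * ((\<rho> + r) ^ m - \<rho> ^ m)) + r * (\<rho> * (\<rho> + r) ^ m)"
    using \<rho> r IH nP W.nonneg
    by (intro add_mono mult_mono order_trans[OF wnorm_pCons_le] mult_left_mono) auto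
  also have "\<dots> = \<rho> * ((\<rho> + r) ^ Suc m - \<rho> ^ Suc m)" by (simp add: algebra_simps)
  finally show ?case using insert by (simp add: m_def)
qed

lemma wnorm_one_plus_power:
  assumes "0 \<le> d"
  shows "wnorm d ([:1, 1:] ^ n) \<le> d * (1 + d) ^ n"
proof (induction n)
  case (Suc n)
  interpret W: poly_seminorm "wnorm d" by (rule poly_seminorm_wnorm) fact
  have "[:1, 1:] ^ Suc n = [:1, 1:] ^ n + pCons 0 ([:1, 1::complex:] ^ n)" by simp
  then have "wnorm d ([:1, 1:] ^ Suc n) \<le> wnorm d ([:1, 1:] ^ n) + d * wnorm d ([:1, 1:] ^ n)"
    using W.add_le wnorm_pCons_le[OF assms] by (smt (verit))
  also have "\<dots> = (1 + d) * wnorm d ([:1, 1:] ^ n)" by (simp add: algebra_simps)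
  also have "\<dots> \<le> (1 + d) * (d * (1 + d) ^ n)" using Suc assms by (intro mult_left_mono) auto
  finally show ?case by (simp add: mult_ac)
qed (simp add: wnorm_one)

lemma prod_linear_dvd:
  fixes p :: "complex poly"
  assumes "finite Z" "\<And>z. z \<in> Z \<Longrightarrow> poly p z = 0"
  shows "(\<Prod>z\<in>Z. [:- z, 1:]) dvd p"
  using assms
proof (induction Z arbitrary: p)
  case (insert z Z)
  then obtain k where k: "p = [:- z, 1:] * k" using poly_eq_0_iff_dvd[of p z] by (auto elim: dvdE)
  have "poly k x = 0" if "x \<in> Z" for x
    using insert.prems[of x] insert.hyps that k by auto
  then have "(\<Prod>z\<in>Z. [:- z, 1:]) dvd k" by (rule insert.IH)
  then show ?case unfolding k prod.insert[OF insert.hyps] by (rule mult_dvd_mono[OF dvd_refl])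
qed simp

lemma degree_prod_linear: "degree (\<Prod>z\<in>Z. [:- z, 1::complex:]) = card Z"
  by (subst degree_prod_eq_sum_degree) auto

lemma coeff_prod_linear: "coeff (\<Prod>z\<in>Z. [:- z, 1::complex:]) (card Z) = 1"
  using lead_coeff_prod[of "\<lambda>z. [:- z, 1:]" Z] by (simp add: degree_prod_linear)

lemma wnorm_le_unit: "0 \<le> d \<Longrightarrow> d \<le> 1 \<Longrightarrow> wnorm d g \<le> d * wnorm 1 g"
  using wnorm_weight_le[of 1 d g] by simp

text \<open>Take \<open>P = z ^ (m + 1) - q / c\<close>, so that \<open>q - c z ^ (m + 1)\<close> is
  \<open>- c P\<close>. As the norm of \<open>q\<close> is at most a constant times
  \<open>\<rho>\<close>, a small \<open>\<rho>\<close> makes the error small.\<close>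

lemma approx_by_monom:
  fixes q :: "complex poly"
  assumes q: "q \<noteq> 0" "degree q \<le> m" and "0 < \<rho>0" "0 < e"
  obtains \<rho> P c where "0 < \<rho>" "\<rho> \<le> \<rho>0" "near_power \<rho> m P" "P dvd q - monom c (Suc m)"
    "wnorm (2 * \<rho>) (q - monom c (Suc m)) \<le> e"
proof -
  define A where "A = wnorm 1 q"
  have A: "0 < A" using q by (simp add: A_def wnorm_pos)
  define K where "K = (2 + 2 ^ (m + 2)) * A"
  have K: "0 < K" using A by (simp add: K_def add_pos_pos)
  define \<rho> where "\<rho> = min \<rho>0 (min (1/2) (e / K))"
  have \<rho>: "0 < \<rho>" "\<rho> \<le> \<rho>0" "2 * \<rho> \<le> 1" "\<rho> * K \<le> e"
  proof -
    have "\<rho> \<le> e / K" "\<rho> \<le> 1 / 2" "\<rho> \<le> \<rho>0" unfolding \<rho>_def by linarith+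
    then show "\<rho> \<le> \<rho>0" "2 * \<rho> \<le> 1" "\<rho> * K \<le> e" using K by (auto simp: field_simps)
  qed (use assms K in \<open>simp add: \<rho>_def\<close>)
  \<comment> \<open>This \<open>c\<close> gives \<open>q / c\<close> exactly the norm allowed by
    \<open>near_power\<close>. The norm of \<open>c z ^ (m + 1)\<close> is then that of
    \<open>q\<close> at weight \<open>\<rho>\<close>, and at weight \<open>2 * \<rho>\<close> it
    grows only by \<open>2 ^ (m + 2)\<close>.\<close>
  define c where "c = wnorm \<rho> q / \<rho> ^ Suc (Suc m)"
  have c: "0 < c" using \<rho> q by (simp add: c_def wnorm_pos)
  define P where "P = monom 1 (Suc m) - [:of_real (1 / c):] * q"
  have dq: "degree ([:of_real (1 / c):] * q) < Suc m" using c q by simp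
  have "degree P = Suc m"
    unfolding P_def diff_conv_add_uminus using dq
    by (subst degree_add_eq_left) (simp_all add: degree_monom_eq)
  moreover have "coeff P (Suc m) = 1"
    using q by (simp add: P_def coeff_eq_0)
  moreover have "P - monom 1 (Suc m) = [:of_real (- (1 / c)):] * q" by (simp add: P_def)
  then have "wnorm \<rho> (P - monom 1 (Suc m)) = \<rho> ^ Suc (Suc m)"
  proof (simp only: wnorm_scale)
    have "wnorm \<rho> q = c * \<rho> ^ Suc (Suc m)" using \<rho> by (simp add: c_def)
    then show "cmod (of_real (- (1 / c))) * wnorm \<rho> q = \<rho> ^ Suc (Suc m)"
      using c by (simp only: norm_of_real) simp
  qed
  ultimately have np: "near_power \<rho> m P" by (simp add: near_power_def)
  have "q - monom (of_real c) (Suc m) = [:of_real (- c):] * P"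
  proof -
    have "[:of_real (- c):] * P = [:of_real c:] * ([:of_real (1 / c):] * q) - [:of_real c:] * monom 1 (Suc m)"
      unfolding P_def by (simp add: smult_diff_right)
    also have "[:of_real c:] * ([:of_real (1 / c):] * q) = q" using c by simp
    also have "[:of_real c:] * monom 1 (Suc m) = monom (complex_of_real c) (Suc m)"
      by (simp add: smult_monom)
    finally show ?thesis ..
  qed
  then have dvd: "P dvd q - monom (of_real c) (Suc m)" by (simp only: dvd_triv_right)
  interpret W: poly_seminorm "wnorm (2 * \<rho>)" using \<rho> by (intro poly_seminorm_wnorm) simp
  have "wnorm (2 * \<rho>) (q - monom (of_real c) (Suc m))
      \<le> wnorm (2 * \<rho>) q + c * (2 * \<rho>) ^ Suc (Suc m)"
    using W.diff_le[of q "monom (of_real c) (Suc m)"] c by (simp add: wnorm_monom)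
  also have "c * (2 * \<rho>) ^ Suc (Suc m) = 2 ^ (m + 2) * wnorm \<rho> q"
    using \<rho> by (simp add: c_def power_mult_distrib)
  also have "wnorm (2 * \<rho>) q + 2 ^ (m + 2) * wnorm \<rho> q \<le> (2 * \<rho>) * A + 2 ^ (m + 2) * (\<rho> * A)"
    unfolding A_def using \<rho> by (intro add_mono mult_left_mono wnorm_le_unit) auto
  also have "\<dots> = \<rho> * K" by (simp add: K_def algebra_simps)
  also have "\<dots> \<le> e" by fact
  finally show ?thesis using \<rho> np dvd that by blast
qed

text \<open>\<open>P\<close> is the product over \<open>m + 1\<close> roots of
  \<open>(1 + z) ^ n = q(z)\<close> of size at most \<open>R / n\<close>. With
  \<open>\<rho> = M * R / n\<close>, a large \<open>M\<close> makes the roots small relative to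
  \<open>\<rho>\<close>, and a large \<open>n\<close> then makes \<open>\<rho>\<close> itself
  small.\<close>

lemma approx_by_one_plus_power:
  fixes q :: "complex poly"
  assumes q: "poly q 0 \<noteq> 0" and "0 < \<rho>0" "0 < e"
  obtains \<rho> P n where "0 < \<rho>" "\<rho> \<le> \<rho>0" "near_power \<rho> m P" "0 < n" "P dvd q - [:1, 1:] ^ n"
    "wnorm (2 * \<rho>) (q - [:1, 1:] ^ n) \<le> e"
proof -
  obtain R where R: "0 < R" and roots: "\<forall>\<^sub>F n in sequentially. \<exists>Z. finite Z \<and> card Z = Suc m \<and>
      (\<forall>z\<in>Z. cmod z \<le> R / n \<and> (1 + z) ^ n = poly q z)"
    using many_small_roots[OF q] by blast
  have "(\<lambda>n. (1 + 1 / real n) ^ Suc m) \<longlonglongrightarrow> (1 + 0) ^ Suc m"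
    by (intro tendsto_intros lim_1_over_n)
  then have "\<forall>\<^sub>F n in sequentially. (1 + 1 / real n) ^ Suc m < 2" by (rule order_tendstoD) simp
  then have "\<forall>\<^sub>F n in sequentially. (1 + 1 / real n) ^ Suc m < 2 \<and> n > 0"
    using eventually_gt_at_top[of 0] by (rule eventually_conj)
  \<comment> \<open>The roots will have size at most \<open>\<rho> / M\<close>; this
    \<open>M\<close> brings the bound of \<open>wnorm_prod_linear\<close> below
    \<open>\<rho> ^ Suc (Suc m)\<close>.\<close>
  then obtain M where M: "(1 + 1 / real M) ^ Suc m < 2" "M > 0"
    by (auto simp: eventually_sequentially)
  define A where "A = wnorm 1 q + exp (2 * M * R)"
  have A: "0 < A" by (simp add: A_def add_nonneg_pos wnorm_nonneg)
  define d where "d = min \<rho>0 (min (1/2) (e / (2 * A)))"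
  have d: "0 < d" using assms A by (simp add: d_def)
  have "\<forall>\<^sub>F n in sequentially. M * R / d < real n"
    using filterlim_at_top_dense[of real sequentially] filterlim_real_sequentially by auto
  with roots obtain n Z where n: "M * R / d < real n" and Z: "finite Z" "card Z = Suc m"
      "\<And>z. z \<in> Z \<Longrightarrow> cmod z \<le> R / n" "\<And>z. z \<in> Z \<Longrightarrow> (1 + z) ^ n = poly q z"
    using eventually_happens'[OF sequentially_bot eventually_conj] by blast
  have n0: "0 < n" using n M R d by (smt (verit) divide_pos_pos mult_pos_pos of_nat_0_less_iff)
  define \<rho> where "\<rho> = M * R / n"
  have \<rho>: "0 < \<rho>" "\<rho> \<le> d" using n n0 M R d by (auto simp: \<rho>_def field_simps)
  define P where "P = (\<Prod>z\<in>Z. [:- z, 1:])"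
  have "wnorm \<rho> (P - monom 1 (Suc m)) \<le> \<rho> * ((\<rho> + R / n) ^ Suc m - \<rho> ^ Suc m)"
    using wnorm_prod_linear[of \<rho> Z "R / n"] Z \<rho> by (simp add: P_def)
  also have "\<rho> + R / n = \<rho> * (1 + 1 / M)" using M(2) n0 by (simp add: \<rho>_def field_simps)
  also have "\<rho> * ((\<rho> * (1 + 1 / M)) ^ Suc m - \<rho> ^ Suc m) = \<rho> ^ Suc (Suc m) * ((1 + 1 / M) ^ Suc m - 1)"
    unfolding power_mult_distrib by (simp add: algebra_simps)
  also have "\<dots> \<le> \<rho> ^ Suc (Suc m) * 1" using M \<rho> by (intro mult_left_mono) auto
  finally have np: "near_power \<rho> m P"
    using degree_prod_linear[of Z] coeff_prod_linear[of Z] Z by (simp add: near_power_def P_def)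
  have dvd: "P dvd q - [:1, 1:] ^ n"
    unfolding P_def using Z by (intro prod_linear_dvd) (auto simp: poly_power)
  have d': "\<rho> \<le> \<rho>0" "2 * \<rho> \<le> 1" "\<rho> * (2 * A) \<le> e" using \<rho> A by (auto simp: d_def field_simps)
  interpret W: poly_seminorm "wnorm (2 * \<rho>)" using \<rho> by (intro poly_seminorm_wnorm) simp
  have "wnorm (2 * \<rho>) (q - [:1, 1:] ^ n) \<le> wnorm (2 * \<rho>) q + wnorm (2 * \<rho>) ([:1, 1:] ^ n)"
    by (rule W.diff_le)
  also have "\<dots> \<le> 2 * \<rho> * wnorm 1 q + 2 * \<rho> * (1 + 2 * \<rho>) ^ n"
    using \<rho> d' by (intro add_mono wnorm_le_unit wnorm_one_plus_power) auto
  \<comment> \<open>Since \<open>n * \<rho> = M * R\<close>, this factor is bounded independently of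
    \<open>n\<close>, and the factor \<open>2 * \<rho>\<close> in front of it makes the term
    small.\<close>
  also have "(1 + 2 * \<rho>) ^ n \<le> exp (2 * \<rho>) ^ n"
    using \<rho> by (intro power_mono exp_ge_add_one_self) auto
  also have "exp (2 * \<rho>) ^ n = exp (2 * M * R)"
    using n0 by (simp add: \<rho>_def flip: exp_of_nat_mult)
  also have "2 * \<rho> * wnorm 1 q + 2 * \<rho> * exp (2 * M * R) = \<rho> * (2 * A)"
    by (simp add: A_def algebra_simps)
  also have "\<dots> \<le> e" by fact
  finally show ?thesis using \<rho> np dvd d' n0 that \<rho> by (auto simp: mult_left_mono)
qed

subsection \<open>The limit norm\<close>

text \<open>Divisibility makes the extended seminorm vanish on \<open>q - y\<close>. The weight
  \<open>2 * \<rho>\<close> is the next radius, so the last condition limits how much later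
  extensions can add to \<open>q - y\<close> again.\<close>

definition approximable :: "complex poly \<Rightarrow> complex poly set \<Rightarrow> bool" where
  "approximable q Y \<longleftrightarrow> (\<forall>m \<rho>0 e. degree q \<le> m \<and> 0 < \<rho>0 \<and> 0 < e \<longrightarrow>
     (\<exists>\<rho> P y. 0 < \<rho> \<and> \<rho> \<le> \<rho>0 \<and> near_power \<rho> m P \<and> y \<in> Y \<and> P dvd q - y
        \<and> wnorm (2 * \<rho>) (q - y) \<le> e))"

lemma approximable_monom: "q \<noteq> 0 \<Longrightarrow> approximable q {monom c n | c n. True}"
  unfolding approximable_def
proof (intro allI impI)
  fix m and \<rho>0 e :: real assume q: "q \<noteq> 0" and *: "degree q \<le> m \<and> 0 < \<rho>0 \<and> 0 < e"
  obtain \<rho> P c where "0 < \<rho>" "\<rho> \<le> \<rho>0" "near_power \<rho> m P" "P dvd q - monom c (Suc m)"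
      "wnorm (2 * \<rho>) (q - monom c (Suc m)) \<le> e"
    by (rule approx_by_monom[of q m \<rho>0 e]) (use q * in auto)
  then show "\<exists>\<rho> P y. 0 < \<rho> \<and> \<rho> \<le> \<rho>0 \<and> near_power \<rho> m P \<and> y \<in> {monom c n | c n. True} \<and> P dvd q - y
      \<and> wnorm (2 * \<rho>) (q - y) \<le> e" by blast
qed

lemma approximable_one_plus_power:
  "poly q 0 \<noteq> 0 \<Longrightarrow> approximable q {[:1, 1:] ^ n | n. 0 < n}"
  unfolding approximable_def
proof (intro allI impI)
  fix m and \<rho>0 e :: real assume q: "poly q 0 \<noteq> 0" and *: "degree q \<le> m \<and> 0 < \<rho>0 \<and> 0 < e"
  obtain \<rho> P n where "0 < \<rho>" "\<rho> \<le> \<rho>0" "near_power \<rho> m P" "0 < n" "P dvd q - [:1, 1:] ^ n"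
      "wnorm (2 * \<rho>) (q - [:1, 1:] ^ n) \<le> e"
    by (rule approx_by_one_plus_power[of q \<rho>0 e m]) (use q * in auto)
  then show "\<exists>\<rho> P y. 0 < \<rho> \<and> \<rho> \<le> \<rho>0 \<and> near_power \<rho> m P \<and> y \<in> {[:1, 1:] ^ n | n. 0 < n} \<and> P dvd q - y
      \<and> wnorm (2 * \<rho>) (q - y) \<le> e" by blast
qed

definition admissible :: "(complex poly \<Rightarrow> real) \<Rightarrow> real \<Rightarrow> bool" where
  "admissible s d \<longleftrightarrow> poly_alg_seminorm s \<and> 0 < d \<and> d \<le> 1 \<and> radius_below s d"

text \<open>One stage of the construction: the error \<open>q - y\<close> gets seminorm 0, while on
  degrees up to \<open>D\<close> the old seminorm only gains \<open>wnorm d\<close>.\<close>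

lemma extension_step:
  assumes "admissible s d" and qY: "approximable q Y" and e: "0 < e"
  obtains s' d' D' y where "admissible s' d'" "d' \<le> d / 2" "D < D'"
    "\<And>g. degree g \<le> D \<Longrightarrow> s' g = s g + wnorm d g"
    "y \<in> Y" "s' (q - y) = 0" "wnorm d' (q - y) \<le> e" "degree (q - y) \<le> D'"
proof -
  have s: "poly_alg_seminorm s" and d: "0 < d" "d \<le> 1" and rad: "radius_below s d"
    using assms by (auto simp: admissible_def)
  interpret poly_alg_seminorm s by (rule s)
  obtain L where L: "\<And>l. L \<le> l \<Longrightarrow> s (monom 1 l) \<le> d ^ Suc l / 2"
    using rad by (auto simp: radius_below_def eventually_sequentially)
  \<comment> \<open>\<open>L\<close> gives the decay of monomials beyond \<open>m\<close>,
    \<open>D\<close> leaves the old degrees unreduced, and \<open>degree q\<close> lets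
    \<open>approximable\<close> be applied.\<close>
  define m where "m = L + D + degree q"
  have "s (monom 1 l) \<le> d ^ Suc l / 2" if "m < l" for l
    using that by (intro L) (simp add: m_def)
  then obtain \<rho>0 where \<rho>0: "0 < \<rho>0" "\<And>\<rho> P. 0 < \<rho> \<Longrightarrow> \<rho> \<le> \<rho>0 \<Longrightarrow> near_power \<rho> m P \<Longrightarrow>
      poly_alg_seminorm (extend s d P) \<and> radius_below (extend s d P) (2 * \<rho>)"
    using extend_near_power[OF s d, of m] by blast
  obtain \<rho> P y where \<rho>: "0 < \<rho>" "\<rho> \<le> min \<rho>0 (d / 4)" and P: "near_power \<rho> m P"
      and y: "y \<in> Y" "P dvd q - y" "wnorm (2 * \<rho>) (q - y) \<le> e"
  proof -
    have "degree q \<le> m \<and> 0 < min \<rho>0 (d / 4) \<and> 0 < e" using \<rho>0 d e by (simp add: m_def)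
    then obtain \<rho> P y where "0 < \<rho> \<and> \<rho> \<le> min \<rho>0 (d / 4) \<and> near_power \<rho> m P \<and> y \<in> Y \<and> P dvd q - y
        \<and> wnorm (2 * \<rho>) (q - y) \<le> e"
      using qY[unfolded approximable_def, rule_format, of m "min \<rho>0 (d / 4)" e] by auto
    then show ?thesis using that by blast
  qed
  show ?thesis
  \<comment> \<open>The new degree bound covers \<open>q - y\<close>, so that later stages do not
    reduce it and can only add their weighted norms.\<close>
  proof (rule that[of "extend s d P" "2 * \<rho>" "Suc (max D (degree (q - y)))" y])
    show "admissible (extend s d P) (2 * \<rho>)"
      using \<rho>0(2)[of \<rho> P] \<rho> P d by (simp add: admissible_def)
    show "extend s d P g = s g + wnorm d g" if "degree g \<le> D" for g
    proof -
      have "g mod P = g" using that P by (intro mod_poly_less) (simp add: near_power_def m_def)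
      then show ?thesis by (simp add: extend_def)
    qed
    show "extend s d P (q - y) = 0"
      using y(2) by (simp add: extend_def zero wnorm_def mod_eq_0_iff_dvd)
  qed (use \<rho> y in auto)
qed

text \<open>For fixed \<open>g\<close> the values \<open>s k g\<close> increase once
  \<open>D k\<close> reaches the degree of \<open>g\<close>, by \<open>wnorm (d k) g\<close> at each
  stage. As the radii at least halve, these increments are dominated by a geometric series. So the
  limit exists and exceeds \<open>s k g\<close> by at most \<open>2 * wnorm (d k) g\<close>.\<close>

lemma exists_norm_approx:
  fixes q :: "nat \<Rightarrow> complex poly" and e :: "nat \<Rightarrow> real"
  assumes qY: "\<And>k. approximable (q k) (Y k)" and e: "\<And>k. 0 < e k"
  obtains S where "poly_alg_seminorm S" "\<And>g. g \<noteq> 0 \<Longrightarrow> 0 < S g"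
    "\<And>k. \<exists>y\<in>Y k. S (q k - y) \<le> 2 * e k"
proof -
  define step where "step k x x' \<longleftrightarrow> (case (x, x') of ((s, d, D), (s', d', D')) \<Rightarrow>
      d' \<le> d / 2 \<and> D < D' \<and> (\<forall>g. degree g \<le> D \<longrightarrow> s' g = s g + wnorm d g) \<and>
      (\<exists>y\<in>Y k. s' (q k - y) = 0 \<and> wnorm d' (q k - y) \<le> e k \<and> degree (q k - y) \<le> D'))"
    for k and x x' :: "(complex poly \<Rightarrow> real) \<times> real \<times> nat"
  have "\<exists>f. \<forall>k. (case f k of (s, d, D) \<Rightarrow> admissible s d) \<and> step k (f k) (f (Suc k))"
  proof (rule dependent_nat_choice)
    \<comment> \<open>The construction starts from the zero seminorm; definiteness comes entirely
      from the weighted norms added later.\<close>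
    have "admissible (\<lambda>_. 0) 1"
      by (auto simp: admissible_def radius_below_def poly_alg_seminorm_def poly_seminorm_def
          poly_alg_seminorm_axioms_def)
    then show "\<exists>x. case x of (s, d, D) \<Rightarrow> admissible s d" by auto
  next
    fix x :: "(complex poly \<Rightarrow> real) \<times> real \<times> nat" and k
    assume "case x of (s, d, D) \<Rightarrow> admissible s d"
    then obtain s d D where x: "x = (s, d, D)" and adm: "admissible s d" by (cases x) auto
    obtain s' d' D' y where new: "admissible s' d'" "d' \<le> d / 2" "D < D'"
        "\<And>g. degree g \<le> D \<Longrightarrow> s' g = s g + wnorm d g"
        "y \<in> Y k" "s' (q k - y) = 0" "wnorm d' (q k - y) \<le> e k" "degree (q k - y) \<le> D'"
      using extension_step[OF adm qY[of k] e[of k], where D = D] by metis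
    then have "step k x (s', d', D')" unfolding step_def x by auto
    with new(1) show "\<exists>x'. (case x' of (s, d, D) \<Rightarrow> admissible s d) \<and> step k x x'" by auto
  qed
  then obtain f where "\<forall>k. (case f k of (s, d, D) \<Rightarrow> admissible s d) \<and> step k (f k) (f (Suc k))" ..
  then have f: "case f k of (s, d, D) \<Rightarrow> admissible s d" "step k (f k) (f (Suc k))" for k
    by simp_all
  define s d D where "s k = fst (f k)" and "d k = fst (snd (f k))" and "D k = snd (snd (f k))" for k
  have f_eq: "f k = (s k, d k, D k)" for k by (simp add: s_def d_def D_def)
  have s: "poly_alg_seminorm (s k)" and d: "0 < d k" for k
    using f(1)[of k] by (auto simp: f_eq admissible_def)
  have d_half: "d (Suc k) \<le> d k / 2" and D_less: "D k < D (Suc k)"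
    and s_Suc: "\<And>g. degree g \<le> D k \<Longrightarrow> s (Suc k) g = s k g + wnorm (d k) g"
    and task: "\<exists>y\<in>Y k. s (Suc k) (q k - y) = 0 \<and> wnorm (d (Suc k)) (q k - y) \<le> e k
        \<and> degree (q k - y) \<le> D (Suc k)" for k
    using f(2)[of k] by (auto simp: step_def f_eq)
  have D_mono: "D k \<le> D (k + i)" for k i
    by (induction i) (use D_less in \<open>auto intro: order_trans less_imp_le\<close>)
  have D_ge: "k \<le> D k" for k
    by (induction k) (use D_less in \<open>auto simp: Suc_le_eq intro: le_less_trans\<close>)
  have d_decay: "d (k + i) \<le> (1/2) ^ i * d k" for k i
  proof (induction i)
    case (Suc i)
    then show ?case using d_half[of "k + i"] by simp
  qed simp
  have wnorm_decay: "wnorm (d (k + i)) g \<le> (1/2) ^ i * wnorm (d k) g" for k i g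
  proof -
    let ?c = "d (k + i) / d k"
    have c: "0 \<le> ?c" "?c \<le> (1/2) ^ i" using d[of k] d[of "k + i"] d_decay[of k i] by (auto simp: field_simps)
    have "(1/2::real) ^ i \<le> 1" by (rule power_le_one) auto
    with c have "?c \<le> 1" by linarith
    then have "wnorm (?c * d k) g \<le> ?c * wnorm (d k) g"
      using c d[of k] by (intro wnorm_weight_le) simp_all
    also have "\<dots> \<le> (1/2) ^ i * wnorm (d k) g"
      using c d[of k] by (intro mult_right_mono wnorm_nonneg) auto
    finally show ?thesis using d[of k] by simp
  qed
  \<comment> \<open>\<open>2 - 2 * (1/2) ^ i\<close> is the sum of the first \<open>i\<close> terms
    of the series 1 + 1/2 + 1/4 + ....\<close>
  have s_upper: "s (k + i) g \<le> s k g + (2 - 2 * (1/2) ^ i) * wnorm (d k) g" if g: "degree g \<le> D k" for k i g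
  proof (induction i)
    case (Suc i)
    have "s (k + Suc i) g = s (k + i) g + wnorm (d (k + i)) g"
      using s_Suc[of g "k + i"] g D_mono[of k i] by simp
    also have "\<dots> \<le> s k g + (2 - 2 * (1/2) ^ i) * wnorm (d k) g + (1/2) ^ i * wnorm (d k) g"
      using Suc wnorm_decay[of k i g] by linarith
    also have "\<dots> = s k g + (2 - 2 * (1/2) ^ Suc i) * wnorm (d k) g" by (simp add: algebra_simps)
    finally show ?case .
  qed simp
  have s_upper': "s (k + i) g \<le> s k g + 2 * wnorm (d k) g" if g: "degree g \<le> D k" for k i g
  proof -
    have "(2 - 2 * (1/2) ^ i) * wnorm (d k) g \<le> 2 * wnorm (d k) g"
      using d[of k] by (intro mult_right_mono wnorm_nonneg) auto
    then show ?thesis using s_upper[OF g, of i] by linarith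
  qed
  have s_mono: "incseq (\<lambda>i. s (k + i) g)" if g: "degree g \<le> D k" for k g
  proof (rule incseq_SucI)
    fix i
    show "s (k + i) g \<le> s (k + Suc i) g"
      using s_Suc[of g "k + i"] g D_mono[of k i] wnorm_nonneg[of "d (k + i)" g] d[of "k + i"] by simp
  qed
  define S where "S g = lim (\<lambda>k. s k g)" for g
  have lim: "(\<lambda>k. s k g) \<longlonglongrightarrow> S g" for g
  proof -
    have "degree g \<le> D (degree g)" by (rule D_ge)
    then obtain L where "(\<lambda>i. s (degree g + i) g) \<longlonglongrightarrow> L"
      using incseq_convergent[OF s_mono] s_upper' by metis
    then have "(\<lambda>i. s (i + degree g) g) \<longlonglongrightarrow> L" by (simp add: add.commute)
    then have "(\<lambda>k. s k g) \<longlonglongrightarrow> L" by (rule LIMSEQ_offset)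
    then show ?thesis unfolding S_def by (simp add: limI)
  qed
  have lim': "(\<lambda>i. s (k + i) g) \<longlonglongrightarrow> S g" for k g
    using LIMSEQ_ignore_initial_segment[OF lim[of g], of k] by (simp add: add.commute)
  have S_upper: "S g \<le> s k g + 2 * wnorm (d k) g" if "degree g \<le> D k" for k g
    using s_upper'[OF that] by (intro LIMSEQ_le_const2[OF lim'[of k]]) auto
  have S_lower: "s k g \<le> S g" if "degree g \<le> D k" for k g
    using incseq_le[OF s_mono[OF that] lim', of 0] by simp
  show ?thesis
  proof (rule that[of S])
    show "poly_alg_seminorm S"
    proof
      fix g h c
      show "S (g + h) \<le> S g + S h"
        using s by (intro LIMSEQ_le[OF lim tendsto_add[OF lim lim]])
          (auto simp: poly_alg_seminorm_def poly_seminorm_def)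
      have "(\<lambda>k. s k ([:c:] * g)) = (\<lambda>k. cmod c * s k g)"
        using s unfolding poly_alg_seminorm_def poly_seminorm_def by blast
      then show "S ([:c:] * g) = cmod c * S g"
        using LIMSEQ_unique[OF lim[of "[:c:] * g"]] tendsto_mult_left[OF lim[of g], of "cmod c"] by simp
      show "S (pCons 0 (g * h)) \<le> S g * S h"
        using s by (intro LIMSEQ_le[OF lim tendsto_mult[OF lim lim]])
          (auto simp: poly_alg_seminorm_def poly_alg_seminorm_axioms_def)
    qed
    show "0 < S g" if "g \<noteq> 0" for g
    proof -
      let ?k = "degree g"
      interpret poly_alg_seminorm "s ?k" by (rule s)
      have deg: "degree g \<le> D ?k" by (rule D_ge)
      \<comment> \<open>The increment at stage \<open>degree g\<close> is already positive, and from
        then on the values do not decrease.\<close>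
      have "0 < s ?k g + wnorm (d ?k) g"
        using nonneg[of g] wnorm_pos[OF d that] by (simp add: add_nonneg_pos)
      also have "\<dots> = s (Suc ?k) g" using s_Suc[OF deg] by simp
      also have "\<dots> \<le> S g" using deg D_less[of ?k] by (intro S_lower) simp
      finally show ?thesis .
    qed
    show "\<exists>y\<in>Y k. S (q k - y) \<le> 2 * e k" for k
    proof -
      obtain y where y: "y \<in> Y k" "s (Suc k) (q k - y) = 0" "wnorm (d (Suc k)) (q k - y) \<le> e k"
          "degree (q k - y) \<le> D (Suc k)"
        using task[of k] by blast
      then have "S (q k - y) \<le> 2 * e k" using S_upper[OF y(4)] by linarith
      then show ?thesis using y(1) by blast
    qed
  qed
qed

section \<open>Countably many targets suffice\<close>

lemma rational_near:
  fixes z :: complex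
  assumes "0 < e"
  shows "\<exists>a b. cmod (Complex (of_rat a) (of_rat b) - z) < e \<and> Complex (of_rat a) (of_rat b) \<noteq> 0"
proof -
  \<comment> \<open>bounding by \<open>u\<close> keeps \<open>a\<close> away from 0\<close>
  define u where "u = (if Re z < 0 then min 0 (Re z + e / 2) else Re z + e / 2)"
  have "Re z < u" using assms by (simp add: u_def)
  then obtain a where a: "Re z < of_rat a" "of_rat a < u" using of_rat_dense by blast
  obtain b where b: "Im z < of_rat b" "of_rat b < Im z + e / 2"
    using of_rat_dense[of "Im z" "Im z + e / 2"] assms by auto
  let ?w = "Complex (of_rat a) (of_rat b)"
  have "cmod (?w - z) \<le> \<bar>Re (?w - z)\<bar> + \<bar>Im (?w - z)\<bar>" by (rule cmod_le)
  also have "\<dots> < e" using a b by (auto simp: u_def split: if_splits)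
  finally have "cmod (?w - z) < e" .
  moreover have "?w \<noteq> 0" using a by (auto simp: u_def complex_eq_iff split: if_splits)
  ultimately show ?thesis by blast
qed

text \<open>Only countably many requirements can be met in turn, so the targets are polynomials with
  complex rational coefficients. Each is paired with every accuracy \<open>1 / (j + 1)\<close> and
  with both approximating families. Other polynomials are reached by perturbing
  coefficients.\<close>

lemma exists_chaotic_norm:
  obtains S where "poly_alg_seminorm S" "\<And>g. g \<noteq> 0 \<Longrightarrow> 0 < S g"
    "\<And>q e. 0 < e \<Longrightarrow> \<exists>c n. S (q - monom c n) < e"
    "\<And>q e. 0 < e \<Longrightarrow> \<exists>n>0. S (q - [:1, 1:] ^ n) < e"
proof -
  define rp where "rp xs = Poly (map (\<lambda>(a, b). Complex (of_rat a) (of_rat b)) xs)"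
    for xs :: "(rat \<times> rat) list"
  define Y where "Y b = (if b then {monom c n | c n. True} else {[:1, 1:] ^ n | n. 0 < n} :: complex poly set)" for b
  \<comment> \<open>Powers of \<open>1 + z\<close> need a target with nonzero value at 0, so every
    other list of coefficients is sent to the harmless target 1.\<close>
  define q where "q xs = (if poly (rp xs) 0 = 0 then 1 else rp xs)" for xs
  have q0: "poly (q xs) 0 \<noteq> 0" for xs by (simp add: q_def)
  have appr: "approximable (q xs) (Y b)" for xs b
  proof (cases b)
    case True
    have "q xs \<noteq> 0" using q0[of xs] by auto
    then show ?thesis unfolding Y_def if_P[OF True] by (rule approximable_monom)
  next
    case False
    show ?thesis unfolding Y_def if_not_P[OF False] by (rule approximable_one_plus_power[OF q0])
  qed
  define task where "task = (from_nat :: nat \<Rightarrow> (rat \<times> rat) list \<times> nat \<times> bool)"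
  have task_surj: "\<exists>k. task k = t" for t using from_nat_to_nat[of t] unfolding task_def by blast
  obtain S where S: "poly_alg_seminorm S" "\<And>g. g \<noteq> 0 \<Longrightarrow> 0 < S g"
    "\<And>k. \<exists>y\<in>Y (snd (snd (task k))). S (q (fst (task k)) - y) \<le> 2 * (1 / Suc (fst (snd (task k))))"
    using exists_norm_approx[of "\<lambda>k. q (fst (task k))" "\<lambda>k. Y (snd (snd (task k)))"
        "\<lambda>k. 1 / Suc (fst (snd (task k)))", OF appr] by auto
  have main: "\<exists>y\<in>Y b. S (p - y) < e" if e: "0 < e" for p e b
  proof -
    interpret poly_alg_seminorm S by (rule S)
    obtain C where C: "0 < C" "\<And>g. degree g \<le> degree p \<Longrightarrow> S g \<le> C * wnorm 1 g"
      using le_const_wnorm by blast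
    define m where "m = Suc (degree p)"
    \<comment> \<open>Each of the \<open>m\<close> coefficients may be off by \<open>h\<close>, so
      the total error is at most \<open>C * m * h = e / 4\<close>.\<close>
    define h where "h = e / (4 * C * m)"
    have h: "0 < h" using e C by (simp add: h_def m_def)
    have "\<forall>i. \<exists>x. cmod (Complex (of_rat (fst x)) (of_rat (snd x)) - coeff p i) < h \<and>
        Complex (of_rat (fst x)) (of_rat (snd x)) \<noteq> 0"
      using rational_near[OF h] by auto
    then obtain F where F: "\<And>i. cmod (Complex (of_rat (fst (F i))) (of_rat (snd (F i))) - coeff p i) < h"
        "\<And>i. Complex (of_rat (fst (F i))) (of_rat (snd (F i))) \<noteq> 0"
      by metis
    define xs where "xs = map F [0..<m]"
    have coeff_xs: "coeff (rp xs) i = (if i < m then Complex (of_rat (fst (F i))) (of_rat (snd (F i))) else 0)" for i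
      by (simp add: rp_def xs_def nth_default_def case_prod_unfold del: upt_Suc)
    have q_eq: "q xs = rp xs" using F(2)[of 0] coeff_xs[of 0] by (simp add: q_def poly_0_coeff_0 m_def)
    have deg: "degree (p - rp xs) \<le> degree p"
      by (rule degree_le) (simp add: coeff_xs m_def coeff_eq_0)
    have "wnorm 1 (p - rp xs) \<le> (\<Sum>i\<le>degree p. h)"
      unfolding wnorm_alt[OF deg]
    proof (rule sum_mono)
      fix i assume "i \<in> {..degree p}"
      then show "cmod (coeff (p - rp xs) i) * 1 ^ Suc i \<le> h"
        using F(1)[of i] by (simp add: coeff_xs m_def norm_minus_commute)
    qed
    also have "\<dots> = m * h" by (simp add: m_def)
    finally have "S (p - rp xs) \<le> C * (m * h)" 
      using C(1) by (intro order_trans[OF C(2)[OF deg]] mult_left_mono) auto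
    also have "\<dots> = e / 4" using C by (simp add: h_def m_def)
    finally have 1: "S (p - rp xs) \<le> e / 4" .
    obtain j where j: "inverse (Suc j) < e / 4" using reals_Archimedean[of "e / 4"] e by auto
    obtain k where k: "task k = (xs, j, b)" using task_surj by blast
    obtain y where y: "y \<in> Y b" "S (rp xs - y) \<le> 2 * (1 / Suc j)" using S(3)[of k] by (auto simp: k q_eq)
    have "S (p - y) \<le> S (p - rp xs) + S (rp xs - y)" by (rule diff_triangle)
    also have "\<dots> < e" using 1 y j e by (simp add: inverse_eq_divide)
    finally show ?thesis using y by blast
  qed
  show ?thesis
  proof (rule that[OF S(1,2)])
    show "\<exists>c n. S (p - monom c n) < e" if "0 < e" for p e
      using main[OF that, of True p] by (auto simp: Y_def)
    show "\<exists>n>0. S (p - [:1, 1:] ^ n) < e" if "0 < e" for p e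
      using main[OF that, of False p] by (auto simp: Y_def)
  qed
qed

subsection \<open>Completion\<close>

text \<open>Gaussian elimination: a pivot in the last equation removes one unknown and one equation.
  If that equation vanishes identically, it is simply dropped.\<close>

lemma homogeneous_system_nontrivial:
  fixes c :: "'i \<Rightarrow> nat \<Rightarrow> complex"
  assumes "finite I" "m < card I"
  shows "\<exists>v. (\<exists>i\<in>I. v i \<noteq> 0) \<and> (\<forall>j<m. (\<Sum>i\<in>I. v i * c i j) = 0)"
  using assms
proof (induction m arbitrary: I c)
  case 0
  then obtain i where "i \<in> I" by fastforce
  then show ?case by (auto intro!: exI[of _ "\<lambda>_. 1"])
next
  case (Suc m)
  show ?case
  proof (cases "\<exists>p\<in>I. c p m \<noteq> 0")
    case False
    obtain v where "\<exists>i\<in>I. v i \<noteq> 0" "\<forall>j<m. (\<Sum>i\<in>I. v i * c i j) = 0"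
      using Suc.IH[of I c] Suc.prems by auto
    with False show ?thesis by (intro exI[of _ v]) (auto simp: less_Suc_eq)
  next
    case True
    then obtain p where p: "p \<in> I" "c p m \<noteq> 0" by blast
    define I' where "I' = I - {p}"
    have I': "finite I'" "m < card I'" "p \<notin> I'" "I = insert p I'"
      using Suc.prems p by (auto simp: I'_def)
    obtain v where v: "\<exists>i\<in>I'. v i \<noteq> 0"
        "\<forall>j<m. (\<Sum>i\<in>I'. v i * (c i j - c i m / c p m * c p j)) = 0"
      using Suc.IH[OF I'(1,2), of "\<lambda>i j. c i j - c i m / c p m * c p j"] by blast
    \<comment> \<open>The pivot unknown is set to the value that solves equation \<open>m\<close>;
      substituting it turns the other equations into the reduced ones solved by
      \<open>v\<close>.\<close>
    define w where "w = v(p := - (\<Sum>i\<in>I'. v i * (c i m / c p m)))"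
    have "(\<Sum>i\<in>I. w i * c i j) = (\<Sum>i\<in>I'. v i * (c i j - c i m / c p m * c p j))" for j
    proof -
      have "(\<Sum>i\<in>I. w i * c i j) = w p * c p j + (\<Sum>i\<in>I'. w i * c i j)"
        unfolding I'(4) using I'(1,3) by simp
      also have "(\<Sum>i\<in>I'. w i * c i j) = (\<Sum>i\<in>I'. v i * c i j)"
        using I'(3) by (intro sum.cong) (auto simp: w_def)
      also have "w p * c p j = - (\<Sum>i\<in>I'. v i * (c i m / c p m * c p j))"
        by (simp add: w_def sum_distrib_right mult.assoc)
      finally show ?thesis by (simp add: sum_subtractf right_diff_distrib)
    qed
    moreover have "(\<Sum>i\<in>I'. v i * (c i m - c i m / c p m * c p m)) = 0" using p by simp
    ultimately have "\<forall>j<Suc m. (\<Sum>i\<in>I. w i * c i j) = 0" using v(2) by (auto simp: less_Suc_eq)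
    moreover have "\<exists>i\<in>I. w i \<noteq> 0" using v(1) I'(3,4) by (auto simp: w_def)
    ultimately show ?thesis by blast
  qed
qed

text \<open>An injection of polynomial sequences into complex sequences, listing all coefficients
  along a pairing of indices.\<close>

definition encode_seq :: "(nat \<Rightarrow> complex poly) \<Rightarrow> nat \<Rightarrow> complex" where
  "encode_seq X k = (case prod_decode k of (n, i) \<Rightarrow> coeff (X n) i)"

lemma inj_encode_seq: "inj encode_seq"
proof (rule injI, rule ext, rule poly_eqI)
  fix X Y n i assume "encode_seq X = encode_seq Y"
  then have "encode_seq X (prod_encode (n, i)) = encode_seq Y (prod_encode (n, i))" by simp
  then show "coeff (X n) i = coeff (Y n) i" by (simp add: encode_seq_def)
qed

section \<open>Cauchy sequences and their limit seminorm\<close>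

context poly_alg_seminorm
begin

definition cauchy_seqs :: "(nat \<Rightarrow> complex poly) set" where
  "cauchy_seqs = {X. \<forall>e>0. \<exists>N. \<forall>m\<ge>N. \<forall>n\<ge>N. s (X m - X n) < e}"

lemma cauchy_seqsD:
  "X \<in> cauchy_seqs \<Longrightarrow> 0 < e \<Longrightarrow> \<exists>N. \<forall>m\<ge>N. \<forall>n\<ge>N. s (X m - X n) < e"
  by (simp add: cauchy_seqs_def)

definition slim :: "(nat \<Rightarrow> complex poly) \<Rightarrow> real" where
  "slim X = lim (\<lambda>n. s (X n))"

lemma tendsto_slim:
  assumes "X \<in> cauchy_seqs"
  shows "(\<lambda>n. s (X n)) \<longlonglongrightarrow> slim X"
proof -
  have "Cauchy (\<lambda>n. s (X n))"
    unfolding Cauchy_def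
  proof (intro allI impI)
    fix e :: real assume "0 < e"
    then obtain N where "\<forall>m\<ge>N. \<forall>n\<ge>N. s (X m - X n) < e" using assms unfolding cauchy_seqs_def by blast
    then show "\<exists>N. \<forall>m\<ge>N. \<forall>n\<ge>N. dist (s (X m)) (s (X n)) < e"
      unfolding dist_real_def by (metis abs_diff_le le_less_trans)
  qed
  then show ?thesis unfolding slim_def by (simp add: Cauchy_convergent_iff convergent_LIMSEQ_iff)
qed

lemma slim_eqI: "(\<lambda>n. s (X n)) \<longlonglongrightarrow> l \<Longrightarrow> slim X = l"
  unfolding slim_def by (rule limI)

lemma slim_const: "slim (\<lambda>_. g) = s g"
  by (rule slim_eqI) simp

lemma cauchy_const: "(\<lambda>_. g) \<in> cauchy_seqs"
  by (simp add: cauchy_seqs_def zero)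

lemma cauchy_add:
  assumes "X \<in> cauchy_seqs" "Y \<in> cauchy_seqs"
  shows "(\<lambda>n. X n + Y n) \<in> cauchy_seqs"
  unfolding cauchy_seqs_def
proof (intro CollectI allI impI)
  fix e :: real assume "0 < e"
  then obtain M N where M: "\<forall>m\<ge>M. \<forall>n\<ge>M. s (X m - X n) < e / 2" and N: "\<forall>m\<ge>N. \<forall>n\<ge>N. s (Y m - Y n) < e / 2"
    using cauchy_seqsD[OF assms(1), of "e / 2"] cauchy_seqsD[OF assms(2), of "e / 2"] by auto
  have "s (X m + Y m - (X n + Y n)) < e" if "max M N \<le> m" "max M N \<le> n" for m n
  proof -
    have "s (X m + Y m - (X n + Y n)) \<le> s (X m - X n) + s (Y m - Y n)"
      using add_le[of "X m - X n" "Y m - Y n"] by (simp add: algebra_simps)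
    moreover have "s (X m - X n) < e / 2" "s (Y m - Y n) < e / 2" using M N that by auto
    ultimately show ?thesis by linarith
  qed
  then show "\<exists>N. \<forall>m\<ge>N. \<forall>n\<ge>N. s (X m + Y m - (X n + Y n)) < e" by blast
qed

lemma cauchy_bounded:
  assumes "X \<in> cauchy_seqs"
  obtains B where "0 < B" "\<And>n. s (X n) \<le> B"
proof -
  have "Bseq (\<lambda>n. s (X n))"
    using tendsto_slim[OF assms] by (intro convergent_imp_Bseq convergentI)
  then obtain B where "B > 0" "\<And>n. norm (s (X n)) \<le> B" by (rule BseqE) blast
  then show ?thesis using that[of B] nonneg by (simp add: abs_le_iff)
qed

lemma star_diff_le: "s (pCons 0 (g * h) - pCons 0 (g' * h')) \<le> s g * s (h - h') + s (g - g') * s h'"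
proof -
  have "pCons 0 (g * h) - pCons 0 (g' * h') = pCons 0 (g * (h - h')) + pCons 0 ((g - g') * h')"
    by (simp add: algebra_simps)
  then show ?thesis
    using add_le[of "pCons 0 (g * (h - h'))" "pCons 0 ((g - g') * h')"]
      mult_le[of g "h - h'"] mult_le[of "g - g'" h'] by simp
qed

lemma cauchy_star:
  assumes "X \<in> cauchy_seqs" "Y \<in> cauchy_seqs"
  shows "(\<lambda>n. pCons 0 (X n * Y n)) \<in> cauchy_seqs"
  unfolding cauchy_seqs_def
proof (intro CollectI allI impI)
  fix e :: real assume e: "0 < e"
  obtain B where B: "0 < B" "\<And>n. s (X n) \<le> B" using cauchy_bounded assms(1) by blast
  obtain C where C: "0 < C" "\<And>n. s (Y n) \<le> C" using cauchy_bounded assms(2) by blast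
  have "0 < e / (2 * C)" "0 < e / (2 * B)" using e B C by auto
  then obtain M N where M: "\<forall>m\<ge>M. \<forall>n\<ge>M. s (X m - X n) < e / (2 * C)"
      and N: "\<forall>m\<ge>N. \<forall>n\<ge>N. s (Y m - Y n) < e / (2 * B)"
    using cauchy_seqsD[OF assms(1)] cauchy_seqsD[OF assms(2)] by metis
  have "s (pCons 0 (X m * Y m) - pCons 0 (X n * Y n)) < e" if "max M N \<le> m" "max M N \<le> n" for m n
  proof -
    have "s (pCons 0 (X m * Y m) - pCons 0 (X n * Y n)) \<le> s (X m) * s (Y m - Y n) + s (X m - X n) * s (Y n)"
      by (rule star_diff_le)
    also have "\<dots> \<le> B * s (Y m - Y n) + s (X m - X n) * C"
      using B C nonneg by (intro add_mono mult_mono) (auto intro: less_imp_le)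
    also have "\<dots> < B * (e / (2 * B)) + (e / (2 * C)) * C"
      using B C M N that by (intro add_strict_mono mult_strict_left_mono mult_strict_right_mono) auto
    also have "\<dots> = e" using B C by simp
    finally show ?thesis .
  qed
  then show "\<exists>N. \<forall>m\<ge>N. \<forall>n\<ge>N. s (pCons 0 (X m * Y m) - pCons 0 (X n * Y n)) < e" by blast
qed

lemma cauchy_scale:
  assumes "X \<in> cauchy_seqs"
  shows "(\<lambda>n. [:c:] * X n) \<in> cauchy_seqs"
  unfolding cauchy_seqs_def
proof (intro CollectI allI impI)
  fix e :: real assume e: "0 < e"
  then have "0 < e / (cmod c + 1)" by (simp add: add_nonneg_pos)
  then obtain N where N: "\<forall>m\<ge>N. \<forall>n\<ge>N. s (X m - X n) < e / (cmod c + 1)"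
    using assms unfolding cauchy_seqs_def by blast
  have "s ([:c:] * X m - [:c:] * X n) < e" if "N \<le> m" "N \<le> n" for m n
  proof -
    have "s ([:c:] * X m - [:c:] * X n) = cmod c * s (X m - X n)"
      using scale[of c "X m - X n"] by (simp only: right_diff_distrib)
    also have "\<dots> \<le> (cmod c + 1) * s (X m - X n)" by (intro mult_right_mono nonneg) simp
    also have "\<dots> < (cmod c + 1) * (e / (cmod c + 1))"
      using N that by (intro mult_strict_left_mono) (auto simp: add_nonneg_pos)
    also have "\<dots> = e" by (simp add: add_nonneg_eq_0_iff)
    finally show ?thesis .
  qed
  then show "\<exists>N. \<forall>m\<ge>N. \<forall>n\<ge>N. s ([:c:] * X m - [:c:] * X n) < e" by blast
qed

lemma cauchy_diff:
  assumes "X \<in> cauchy_seqs" "Y \<in> cauchy_seqs"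
  shows "(\<lambda>n. X n - Y n) \<in> cauchy_seqs"
  using cauchy_add[OF assms(1) cauchy_scale[OF assms(2), of "-1"]] by simp

lemma cauchy_minus: "X \<in> cauchy_seqs \<Longrightarrow> (\<lambda>n. - X n) \<in> cauchy_seqs"
  using cauchy_scale[of X "- 1"] by simp

lemmas cauchy_intros = cauchy_const cauchy_add cauchy_scale cauchy_star cauchy_diff

lemma slim_add_le:
  assumes "X \<in> cauchy_seqs" "Y \<in> cauchy_seqs"
  shows "slim (\<lambda>n. X n + Y n) \<le> slim X + slim Y"
  using assms by (intro LIMSEQ_le[OF tendsto_slim tendsto_add[OF tendsto_slim tendsto_slim]])
    (auto intro: cauchy_intros add_le)

lemma slim_scale: "X \<in> cauchy_seqs \<Longrightarrow> slim (\<lambda>n. [:c:] * X n) = cmod c * slim X"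
  by (intro slim_eqI) (simp only: scale tendsto_slim tendsto_mult_left)

lemma slim_star_le:
  assumes "X \<in> cauchy_seqs" "Y \<in> cauchy_seqs"
  shows "slim (\<lambda>n. pCons 0 (X n * Y n)) \<le> slim X * slim Y"
  using assms by (intro LIMSEQ_le[OF tendsto_slim tendsto_mult[OF tendsto_slim tendsto_slim]])
    (auto intro: cauchy_intros mult_le)

lemma slim_diff_triangle:
  assumes "X \<in> cauchy_seqs" "Y \<in> cauchy_seqs" "Z \<in> cauchy_seqs"
  shows "slim (\<lambda>n. X n - Z n) \<le> slim (\<lambda>n. X n - Y n) + slim (\<lambda>n. Y n - Z n)"
  using slim_add_le[OF cauchy_diff[OF assms(1,2)] cauchy_diff[OF assms(2,3)]] by simp

lemma slim_diff_commute: "slim (\<lambda>n. X n - Y n) = slim (\<lambda>n. Y n - X n)"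
  unfolding slim_def by (simp only: diff_commute)

section \<open>Equality up to null sequences\<close>

definition equiv_seq :: "(nat \<Rightarrow> complex poly) \<Rightarrow> (nat \<Rightarrow> complex poly) \<Rightarrow> bool" where
  "equiv_seq X Y \<longleftrightarrow> (\<lambda>n. s (X n - Y n)) \<longlonglongrightarrow> 0"

lemma equiv_refl: "equiv_seq X X"
  by (simp add: equiv_seq_def zero)

lemma equiv_sym: "equiv_seq X Y \<Longrightarrow> equiv_seq Y X"
  by (simp only: equiv_seq_def diff_commute)

lemma null_seqI:
  assumes "\<And>n. s (X n) \<le> b n" "b \<longlonglongrightarrow> 0"
  shows "(\<lambda>n. s (X n)) \<longlonglongrightarrow> 0"
  using assms nonneg by (intro tendsto_sandwich[OF _ _ tendsto_const assms(2)]) auto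

lemma equiv_trans:
  assumes "equiv_seq X Y" "equiv_seq Y Z"
  shows "equiv_seq X Z"
  unfolding equiv_seq_def
  by (rule null_seqI[where b = "\<lambda>n. s (X n - Y n) + s (Y n - Z n)"])
     (use assms in \<open>auto intro: diff_triangle tendsto_add_zero simp: equiv_seq_def\<close>)

lemma equiv_add:
  assumes "equiv_seq X X'" "equiv_seq Y Y'"
  shows "equiv_seq (\<lambda>n. X n + Y n) (\<lambda>n. X' n + Y' n)"
  unfolding equiv_seq_def
proof (rule null_seqI)
  show "s (X n + Y n - (X' n + Y' n)) \<le> s (X n - X' n) + s (Y n - Y' n)" for n
    using add_le[of "X n - X' n" "Y n - Y' n"] by (simp add: algebra_simps)
qed (use assms in \<open>auto intro: tendsto_add_zero simp: equiv_seq_def\<close>)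

lemma equiv_scale:
  assumes "equiv_seq X X'"
  shows "equiv_seq (\<lambda>n. [:c:] * X n) (\<lambda>n. [:c:] * X' n)"
  unfolding equiv_seq_def
proof (rule null_seqI)
  show "s ([:c:] * X n - [:c:] * X' n) \<le> cmod c * s (X n - X' n)" for n
    using scale[of c "X n - X' n"] by (simp only: right_diff_distrib order_refl)
qed (use assms in \<open>auto intro: tendsto_mult_right_zero simp: equiv_seq_def\<close>)

lemma equiv_star:
  assumes "equiv_seq X X'" "equiv_seq Y Y'" "X \<in> cauchy_seqs" "Y' \<in> cauchy_seqs"
  shows "equiv_seq (\<lambda>n. pCons 0 (X n * Y n)) (\<lambda>n. pCons 0 (X' n * Y' n))"
  unfolding equiv_seq_def
proof (rule null_seqI)
  show "s (pCons 0 (X n * Y n) - pCons 0 (X' n * Y' n)) \<le> s (X n) * s (Y n - Y' n) + s (X n - X' n) * s (Y' n)"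
    for n by (rule star_diff_le)
  have "(\<lambda>n. s (X n) * s (Y n - Y' n) + s (X n - X' n) * s (Y' n)) \<longlonglongrightarrow> slim X * 0 + 0 * slim Y'"
    using assms by (intro tendsto_intros tendsto_slim) (auto simp: equiv_seq_def)
  then show "(\<lambda>n. s (X n) * s (Y n - Y' n) + s (X n - X' n) * s (Y' n)) \<longlonglongrightarrow> 0" by simp
qed

lemma equiv_slim:
  assumes "equiv_seq X Y" "Y \<in> cauchy_seqs"
  shows "slim X = slim Y"
proof (rule slim_eqI)
  have "(\<lambda>n. s (X n) - s (Y n)) \<longlonglongrightarrow> 0"
  proof (rule Lim_null_comparison)
    show "\<forall>\<^sub>F n in sequentially. norm (s (X n) - s (Y n)) \<le> s (X n - Y n)"
      unfolding real_norm_def by (intro always_eventually allI abs_diff_le)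
  qed (use assms(1) in \<open>simp only: equiv_seq_def\<close>)
  from tendsto_add[OF this tendsto_slim[OF assms(2)]] show "(\<lambda>n. s (X n)) \<longlonglongrightarrow> slim Y" by simp
qed

lemma equiv_iff_slim:
  assumes "X \<in> cauchy_seqs" "Y \<in> cauchy_seqs"
  shows "equiv_seq X Y \<longleftrightarrow> slim (\<lambda>n. X n - Y n) = 0"
  using tendsto_slim[OF cauchy_diff[OF assms]] slim_eqI[of "\<lambda>n. X n - Y n" 0]
  unfolding equiv_seq_def by auto

text \<open>
  The carrier consists of codes of chosen representatives, because the completion has to live on
  the type of complex sequences.
\<close>

definition cls :: "(nat \<Rightarrow> complex poly) \<Rightarrow> nat \<Rightarrow> complex" where
  "cls X = encode_seq (SOME Y. equiv_seq X Y)"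

definition rep :: "(nat \<Rightarrow> complex) \<Rightarrow> nat \<Rightarrow> complex poly" where
  "rep f = (SOME X. X \<in> cauchy_seqs \<and> cls X = f)"

lemma cls_eq_iff: "cls X = cls Y \<longleftrightarrow> equiv_seq X Y"
proof
  have *: "equiv_seq Z (SOME Y. equiv_seq Z Y)" for Z
    by (rule someI[of _ Z]) (rule equiv_refl)
  assume "cls X = cls Y"
  then have "(SOME Z. equiv_seq X Z) = (SOME Z. equiv_seq Y Z)"
    unfolding cls_def using inj_encode_seq by (simp add: inj_eq)
  then show "equiv_seq X Y" using *[of X] *[of Y] equiv_trans equiv_sym by metis
next
  assume "equiv_seq X Y"
  then have "equiv_seq X = equiv_seq Y" using equiv_trans equiv_sym by blast
  then show "cls X = cls Y" by (simp add: cls_def)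
qed

lemma rep_cls:
  assumes "X \<in> cauchy_seqs"
  shows "rep (cls X) \<in> cauchy_seqs" "equiv_seq (rep (cls X)) X"
proof -
  have "rep (cls X) \<in> cauchy_seqs \<and> cls (rep (cls X)) = cls X"
    unfolding rep_def by (rule someI[of _ X]) (use assms in simp)
  then show "rep (cls X) \<in> cauchy_seqs" "equiv_seq (rep (cls X)) X" by (auto simp: cls_eq_iff)
qed

section \<open>The Banach algebra of classes of Cauchy sequences\<close>

definition completion :: "(nat \<Rightarrow> complex) cba" where
  "completion = \<lparr>carrier = cls ` cauchy_seqs, zero = cls (\<lambda>_. 0),
     add = (\<lambda>f g. cls (\<lambda>n. rep f n + rep g n)),
     smult = (\<lambda>c f. cls (\<lambda>n. [:c:] * rep f n)),
     mult = (\<lambda>f g. cls (\<lambda>n. pCons 0 (rep f n * rep g n))),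
     nrm = (\<lambda>f. slim (rep f))\<rparr>"

lemma carrier_completion: "cba.carrier completion = cls ` cauchy_seqs"
  by (simp add: completion_def)

lemma zero_completion: "cba.zero completion = cls (\<lambda>_. 0)"
  by (simp add: completion_def)

lemma add_completion:
  "X \<in> cauchy_seqs \<Longrightarrow> Y \<in> cauchy_seqs \<Longrightarrow> cba.add completion (cls X) (cls Y) = cls (\<lambda>n. X n + Y n)"
  by (simp add: completion_def cls_eq_iff equiv_add rep_cls)

lemma smult_completion:
  "X \<in> cauchy_seqs \<Longrightarrow> cba.smult completion c (cls X) = cls (\<lambda>n. [:c:] * X n)"
  using equiv_scale[OF rep_cls(2), of X c] by (simp add: completion_def cls_eq_iff)

lemma mult_completion:
  "X \<in> cauchy_seqs \<Longrightarrow> Y \<in> cauchy_seqs \<Longrightarrow> cba.mult completion (cls X) (cls Y) = cls (\<lambda>n. pCons 0 (X n * Y n))"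
  by (simp add: completion_def cls_eq_iff equiv_star rep_cls)

lemma nrm_completion: "X \<in> cauchy_seqs \<Longrightarrow> cba.nrm completion (cls X) = slim X"
  by (simp add: completion_def equiv_slim rep_cls)

lemma sub_completion:
  assumes "X \<in> cauchy_seqs" "Y \<in> cauchy_seqs"
  shows "sub completion (cls X) (cls Y) = cls (\<lambda>n. X n - Y n)"
  using add_completion[OF assms(1) cauchy_scale[OF assms(2), of "- 1"]] assms
  by (simp add: sub_def smult_completion)

lemmas completion_simps =
  carrier_completion zero_completion add_completion smult_completion mult_completion
  nrm_completion sub_completion

text \<open>Pick from the representative of \<open>f k\<close> one polynomial \<open>W k\<close>
  within \<open>1 / Suc k\<close> of its class. By the triangle inequality the sequence
  \<open>W\<close> is Cauchy, and its class is the limit.\<close>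

lemma completion_complete:
  fixes f :: "nat \<Rightarrow> nat \<Rightarrow> complex"
  assumes f: "\<And>n. f n \<in> cls ` cauchy_seqs"
    and cauchy: "\<And>e. 0 < e \<Longrightarrow> \<exists>N. \<forall>m\<ge>N. \<forall>n\<ge>N. cba.nrm completion (sub completion (f m) (f n)) < e"
  shows "\<exists>L\<in>cls ` cauchy_seqs. \<forall>e>0. \<exists>N. \<forall>n\<ge>N. cba.nrm completion (sub completion (f n) L) < e"
proof -
  have "\<forall>k. \<exists>X. X \<in> cauchy_seqs \<and> f k = cls X" using f by blast
  then obtain X where X: "\<And>k. X k \<in> cauchy_seqs" "\<And>k. f k = cls (X k)" by metis
  have "\<forall>k. \<exists>N. \<forall>m\<ge>N. \<forall>n\<ge>N. s (X k m - X k n) < 1 / Suc k"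
    using X(1) unfolding cauchy_seqs_def by simp
  then obtain N where N: "\<And>k m n. N k \<le> m \<Longrightarrow> N k \<le> n \<Longrightarrow> s (X k m - X k n) < 1 / Suc k" by metis
  define W where "W k = X k (N k)" for k
  have XW: "slim (\<lambda>n. X k n - W k) \<le> 1 / Suc k" for k
    using N[of k _ "N k"]
    by (intro LIMSEQ_le_const2[OF tendsto_slim[OF cauchy_diff[OF X(1) cauchy_const]]] exI[of _ "N k"])
       (auto simp: W_def intro: less_imp_le)
  have inv_small: "\<exists>N. \<forall>k\<ge>N. 1 / Suc k < e" if "0 < e" for e :: real
    using order_tendstoD(2)[OF LIMSEQ_inverse_real_of_nat that]
    by (simp add: eventually_sequentially inverse_eq_divide)
  have W: "W \<in> cauchy_seqs"
    unfolding cauchy_seqs_def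
  proof (intro CollectI allI impI)
    fix e :: real assume "0 < e"
    then have e3: "0 < e / 3" by simp
    obtain M1 where M1: "\<forall>m\<ge>M1. \<forall>n\<ge>M1. cba.nrm completion (sub completion (f m) (f n)) < e / 3"
      using cauchy[OF e3] by blast
    obtain M2 where M2: "\<forall>k\<ge>M2. 1 / Suc k < e / 3" using inv_small[OF e3] by blast
    have "s (W i - W j) < e" if ij: "max M1 M2 \<le> i" "max M1 M2 \<le> j" for i j
    proof -
      have "s (W i - W j) = slim (\<lambda>_. W i - W j)" by (simp add: slim_const)
      also have "\<dots> \<le> slim (\<lambda>n. W i - X i n) + slim (\<lambda>n. X i n - W j)"
        by (rule slim_diff_triangle) (auto intro: cauchy_const X)
      also have "slim (\<lambda>n. X i n - W j) \<le> slim (\<lambda>n. X i n - X j n) + slim (\<lambda>n. X j n - W j)"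
        by (rule slim_diff_triangle) (auto intro: cauchy_const X)
      also have "slim (\<lambda>n. W i - X i n) = slim (\<lambda>n. X i n - W i)" by (rule slim_diff_commute)
      finally have "s (W i - W j) \<le> 1 / Suc i + (slim (\<lambda>n. X i n - X j n) + 1 / Suc j)"
        using XW[of i] XW[of j] by linarith
      moreover have "slim (\<lambda>n. X i n - X j n) < e / 3"
        using M1 ij by (auto simp: X completion_simps cauchy_diff)
      moreover have "1 / Suc i < e / 3" "1 / Suc j < e / 3" using M2 ij by auto
      ultimately show ?thesis by linarith
    qed
    then show "\<exists>N. \<forall>m\<ge>N. \<forall>n\<ge>N. s (W m - W n) < e" by blast
  qed
  have "\<exists>M. \<forall>k\<ge>M. cba.nrm completion (sub completion (f k) (cls W)) < e" if "0 < e" for e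
  proof -
    have e3: "0 < e / 3" using that by simp
    obtain M1 where M1: "\<forall>m\<ge>M1. \<forall>n\<ge>M1. s (W m - W n) < e / 3"
      using W e3 unfolding cauchy_seqs_def by blast
    obtain M2 where M2: "\<forall>k\<ge>M2. 1 / Suc k < e / 3" using inv_small[OF e3] by blast
    have "cba.nrm completion (sub completion (f k) (cls W)) < e" if k: "max M1 M2 \<le> k" for k
    proof -
      have "slim (\<lambda>n. W k - W n) \<le> e / 3"
        using M1 k by (intro LIMSEQ_le_const2[OF tendsto_slim[OF cauchy_diff[OF cauchy_const W]]] exI[of _ M1])
          (auto intro: less_imp_le)
      moreover have "1 / Suc k < e / 3" using M2 k by auto
      moreover have "slim (\<lambda>n. X k n - W n) \<le> slim (\<lambda>n. X k n - W k) + slim (\<lambda>n. W k - W n)"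
        by (rule slim_diff_triangle) (auto intro: cauchy_const X W)
      ultimately have "slim (\<lambda>n. X k n - W n) < e" using XW[of k] e3 by linarith
      then show ?thesis by (simp add: X W completion_simps cauchy_diff)
    qed
    then show ?thesis by blast
  qed
  then show ?thesis using W by blast
qed

lemma banach_algebra_completion: "banach_algebra completion"
  unfolding banach_algebra_def carrier_completion ball_simps zero_completion
proof (intro conjI)
  show "\<forall>X\<in>cauchy_seqs. \<forall>Y\<in>cauchy_seqs. cba.nrm completion (cba.add completion (cls X) (cls Y))
      \<le> cba.nrm completion (cls X) + cba.nrm completion (cls Y)"
    by (simp add: completion_simps cauchy_add slim_add_le)
  show "\<forall>c. \<forall>X\<in>cauchy_seqs. cba.nrm completion (cba.smult completion c (cls X)) = cmod c * cba.nrm completion (cls X)"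
    using cauchy_scale slim_scale by (simp add: completion_simps)
  show "\<forall>X\<in>cauchy_seqs. \<forall>Y\<in>cauchy_seqs. cba.nrm completion (cba.mult completion (cls X) (cls Y))
      \<le> cba.nrm completion (cls X) * cba.nrm completion (cls Y)"
    by (simp add: completion_simps cauchy_star slim_star_le)
  show "\<forall>X\<in>cauchy_seqs. (cba.nrm completion (cls X) = 0) = (cls X = cls (\<lambda>_. 0))"
    by (simp add: completion_simps cls_eq_iff equiv_iff_slim cauchy_const)
  show "\<forall>f :: nat \<Rightarrow> nat \<Rightarrow> complex. (\<forall>n. f n \<in> cls ` cauchy_seqs) \<longrightarrow>
      (\<forall>e>0. \<exists>N. \<forall>m\<ge>N. \<forall>n\<ge>N. cba.nrm completion (sub completion (f m) (f n)) < e) \<longrightarrow>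
      (\<exists>L\<in>cls ` cauchy_seqs. \<forall>e>0. \<exists>N. \<forall>n\<ge>N. cba.nrm completion (sub completion (f n) L) < e)"
    by (intro allI impI, rule completion_complete) simp_all
qed (simp_all add: completion_simps cauchy_const cauchy_add cauchy_minus cauchy_star
      cauchy_scale[simplified] add_ac distrib_left distrib_right
      smult_add_left smult_add_right mult_ac)

lemma lincomb_completion:
  assumes "set Xs \<subseteq> cauchy_seqs" "length cs = length Xs"
  shows "(\<lambda>n. \<Sum>j<length Xs. [:cs ! j:] * (Xs ! j) n) \<in> cauchy_seqs
    \<and> lincomb completion (zip cs (map cls Xs)) = cls (\<lambda>n. \<Sum>j<length Xs. [:cs ! j:] * (Xs ! j) n)"
  using assms
proof (induction Xs arbitrary: cs)
  case Nil
  then show ?case by (simp add: cauchy_const zero_completion)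
next
  case (Cons X Xs)
  obtain c cs' where cs: "cs = c # cs'" using Cons.prems by (cases cs) auto
  let ?Z = "\<lambda>n. \<Sum>j<length Xs. [:cs' ! j:] * (Xs ! j) n"
  have IH: "?Z \<in> cauchy_seqs" "lincomb completion (zip cs' (map cls Xs)) = cls ?Z"
    using Cons.IH[of cs'] Cons.prems cs by auto
  have X: "X \<in> cauchy_seqs" using Cons.prems by simp
  have sum: "(\<lambda>n. \<Sum>j<length (X # Xs). [:cs ! j:] * ((X # Xs) ! j) n) = (\<lambda>n. [:c:] * X n + ?Z n)"
    unfolding length_Cons sum.lessThan_Suc_shift by (simp add: cs)
  have "lincomb completion (zip cs (map cls (X # Xs))) = cls (\<lambda>n. [:c:] * X n + ?Z n)"
    using IH X by (simp only: cs list.map zip_Cons_Cons lincomb.simps smult_completion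
        add_completion cauchy_scale)
  then show ?case unfolding sum using IH X cauchy_add cauchy_scale by blast
qed

text \<open>If \<open>m\<close> classes spanned, the \<open>m + 1\<close> constant sequences
  \<open>1, ..., z ^ m\<close> would be dependent up to null sequences. The dependence is a fixed
  nonzero polynomial of seminorm 0, contradicting definiteness.\<close>

lemma infinite_dimensional_completion:
  assumes definite: "\<And>g. g \<noteq> 0 \<Longrightarrow> 0 < s g"
  shows "infinite_dimensional completion"
  unfolding infinite_dimensional_def
proof
  assume "\<exists>xs. set xs \<subseteq> cba.carrier completion \<and> (\<forall>y\<in>cba.carrier completion.
      \<exists>cs. length cs = length xs \<and> y = lincomb completion (zip cs xs))"
  then obtain xs where xs: "set xs \<subseteq> cls ` cauchy_seqs"
      and span: "\<And>y. y \<in> cls ` cauchy_seqs \<Longrightarrow> \<exists>cs. length cs = length xs \<and> y = lincomb completion (zip cs xs)"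
    unfolding carrier_completion by blast
  obtain Xs where Xs: "set Xs \<subseteq> cauchy_seqs" "xs = map cls Xs"
  proof -
    have "xs \<in> lists (cls ` cauchy_seqs)" using xs by (simp add: lists_eq_set)
    then show ?thesis using that unfolding lists_image by (auto simp: lists_eq_set)
  qed
  define m where "m = length Xs"
  have "\<forall>i. \<exists>cs. length cs = m \<and> cls (\<lambda>_. monom 1 i) = lincomb completion (zip cs (map cls Xs))"
    using span[OF imageI[OF cauchy_const]] by (simp add: Xs(2) m_def)
  then obtain cs where cs: "\<And>i. length (cs i) = m"
      "\<And>i. cls (\<lambda>_. monom 1 i) = lincomb completion (zip (cs i) (map cls Xs))" by metis
  define R where "R i n = monom 1 i - (\<Sum>j<m. [:cs i ! j:] * (Xs ! j) n)" for i n
  have R: "(\<lambda>n. s (R i n)) \<longlonglongrightarrow> 0" for i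
  proof -
    have "cls (\<lambda>_. monom 1 i) = cls (\<lambda>n. \<Sum>j<m. [:cs i ! j:] * (Xs ! j) n)"
      using lincomb_completion[OF Xs(1), of "cs i"] cs[of i] by (simp add: m_def)
    then show ?thesis unfolding cls_eq_iff equiv_seq_def R_def .
  qed
  obtain v where v: "\<exists>i\<in>{..m}. v i \<noteq> 0" "\<forall>j<m. (\<Sum>i\<le>m. v i * cs i ! j) = 0"
    using homogeneous_system_nontrivial[of "{..m}" m "\<lambda>i j. cs i ! j"] by auto
  define g where "g = (\<Sum>i\<le>m. monom (v i) i)"
  \<comment> \<open>The choice of \<open>v\<close> cancels the spanning sequences at every index
    \<open>n\<close>, so only the null remainders \<open>R i n\<close> are left, while
    \<open>g\<close> does not depend on \<open>n\<close>.\<close>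
  have g_eq: "g = (\<Sum>i\<le>m. [:v i:] * R i n)" for n
  proof -
    have "(\<Sum>i\<le>m. [:v i:] * (\<Sum>j<m. [:cs i ! j:] * (Xs ! j) n))
        = (\<Sum>i\<le>m. \<Sum>j<m. [:v i * cs i ! j:] * (Xs ! j) n)"
      by (simp add: sum_distrib_left mult.commute)
    also have "\<dots> = (\<Sum>j<m. \<Sum>i\<le>m. [:v i * cs i ! j:] * (Xs ! j) n)" by (rule sum.swap)
    also have "\<dots> = (\<Sum>j<m. [:\<Sum>i\<le>m. v i * cs i ! j:] * (Xs ! j) n)"
      by (simp add: smult_sum)
    also have "\<dots> = 0" using v(2) by simp
    finally have "(\<Sum>i\<le>m. [:v i:] * (\<Sum>j<m. [:cs i ! j:] * (Xs ! j) n)) = 0" .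
    moreover have "[:v i:] * monom 1 i = monom (v i) i" for i by (simp add: smult_monom)
    ultimately show ?thesis
      unfolding R_def g_def right_diff_distrib sum_subtractf by simp
  qed
  have "s g \<le> (\<Sum>i\<le>m. cmod (v i) * s (R i n))" for n
    using sum_le[of "\<lambda>i. [:v i:] * R i n" "{..m}"] unfolding scale g_eq[of n, symmetric] .
  moreover have "(\<lambda>n. \<Sum>i\<le>m. cmod (v i) * s (R i n)) \<longlonglongrightarrow> (\<Sum>i\<le>m. cmod (v i) * 0)"
    by (intro tendsto_intros R)
  ultimately have "s g \<le> 0" by (intro LIMSEQ_le_const[where a = "s g"]) auto
  then have "g = 0" using definite[of g] by fastforce
  moreover have "coeff g i = v i" if "i \<le> m" for i
    using that by (simp add: g_def coeff_sum)
  ultimately show False using v(1) by auto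
qed

text \<open>A late term of a Cauchy sequence, taken as a constant sequence, is close to its class,
  so density among polynomials is enough.\<close>

lemma dense_completion:
  assumes dense: "\<And>q e. 0 < e \<Longrightarrow> \<exists>y\<in>Y. s (q - y) < e"
  shows "dense_in completion ((\<lambda>y. cls (\<lambda>_. y)) ` Y)"
  unfolding dense_in_def carrier_completion ball_simps
proof (intro conjI ballI allI impI)
  show "(\<lambda>y. cls (\<lambda>_. y)) ` Y \<subseteq> cls ` cauchy_seqs" using cauchy_const by blast
  fix X and e :: real assume X: "X \<in> cauchy_seqs" and e: "0 < e"
  then obtain N where N: "\<forall>m\<ge>N. \<forall>n\<ge>N. s (X m - X n) < e / 2"
    using cauchy_seqsD[OF X, of "e / 2"] by auto
  obtain y where y: "y \<in> Y" "s (X N - y) < e / 2" using dense[of "e / 2"] e by auto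
  have "slim (\<lambda>n. X n - X N) \<le> e / 2"
    using N by (intro LIMSEQ_le_const2[OF tendsto_slim[OF cauchy_diff[OF X cauchy_const]]] exI[of _ N])
      (auto intro: less_imp_le)
  moreover have "slim (\<lambda>n. X n - y) \<le> slim (\<lambda>n. X n - X N) + slim (\<lambda>_. X N - y)"
    by (rule slim_diff_triangle) (auto intro: cauchy_const X)
  ultimately have "slim (\<lambda>n. X n - y) < e" using y by (simp add: slim_const)
  then have "cba.nrm completion (sub completion (cls X) (cls (\<lambda>_. y))) < e"
    by (simp add: completion_simps X cauchy_const cauchy_diff)
  then show "\<exists>d\<in>(\<lambda>y. cls (\<lambda>_. y)) ` Y. cba.nrm completion (sub completion (cls X) d) < e" using y(1) by blast
qed

section \<open>The chaotic element\<close>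

lemma apow_completion: "apow completion (cls (\<lambda>_. 1)) (Suc n) = cls (\<lambda>_. monom 1 n)"
  by (induction n) (simp_all add: mult_completion cauchy_const monom_Suc)

text \<open>The class of \<open>g\<close> stands for \<open>z g\<close> in the unitalization, so the
  pair of \<open>g\<close> and 1 stands for \<open>1 + z g\<close>, which must equal
  \<open>(1 + z) ^ n\<close>.\<close>

lemma upow_completion:
  "\<exists>g. upow completion (cls (\<lambda>_. 1), 1) n = (cls (\<lambda>_. g), 1) \<and> 1 + pCons 0 g = [:1, 1:] ^ n"
proof (induction n)
  case 0
  show ?case by (intro exI[of _ 0]) (simp add: zero_completion)
next
  case (Suc n)
  then obtain g where g: "upow completion (cls (\<lambda>_. 1), 1) n = (cls (\<lambda>_. g), 1)"
      "1 + pCons 0 g = [:1, 1:] ^ n" by blast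
  \<comment> \<open>In \<open>(1 + a) * (1 + g)\<close> the product \<open>a * g\<close> contributes
    \<open>z g\<close>, while the two units contribute \<open>g\<close> and the generator 1.\<close>
  have "upow completion (cls (\<lambda>_. 1), 1) (Suc n) = (cls (\<lambda>_. pCons 0 g + g + 1), 1)"
    unfolding upow.simps g(1) by (simp add: umult_def completion_simps cauchy_const one_pCons)
  moreover have "1 + pCons 0 (pCons 0 g + g + 1) = [:1, 1:] * (1 + pCons 0 g)"
    by (simp add: one_pCons algebra_simps)
  ultimately show ?case using g(2) by (intro exI[of _ "pCons 0 g + g + 1"]) simp
qed

text \<open>Multiplying \<open>1 + z g\<close> by the generator gives the class of
  \<open>z g + 1\<close>, so \<open>(1 + a) ^ n a\<close> corresponds exactly to
  \<open>(1 + z) ^ n\<close>.\<close>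

lemma umult_upow_completion:
  "fst (umult completion (upow completion (cls (\<lambda>_. 1), 1) n) (cls (\<lambda>_. 1), 0)) = cls (\<lambda>_. [:1, 1:] ^ n)"
proof -
  obtain g where g: "upow completion (cls (\<lambda>_. 1), 1) n = (cls (\<lambda>_. g), 1)"
      "1 + pCons 0 g = [:1, 1:] ^ n" using upow_completion by blast
  have "fst (umult completion (cls (\<lambda>_. g), 1) (cls (\<lambda>_. 1), 0)) = cls (\<lambda>_. pCons 0 g + 1)"
    by (simp add: umult_def completion_simps cauchy_const one_pCons)
  also have "pCons 0 g + 1 = [:1, 1:] ^ n" using g(2) by (simp add: add.commute)
  finally show ?thesis unfolding g(1) .
qed

lemma chaotic_elem_completion:
  assumes "\<And>q e. 0 < e \<Longrightarrow> \<exists>c n. s (q - monom c n) < e"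
    and "\<And>q e. 0 < e \<Longrightarrow> \<exists>n>0. s (q - [:1, 1:] ^ n) < e"
  shows "chaotic_elem completion (cls (\<lambda>_. 1))"
proof -
  let ?a = "cls (\<lambda>_. 1)"
  have a: "?a \<in> cba.carrier completion" using cauchy_const by (simp add: carrier_completion)
  have scaled: "cba.smult completion c (apow completion ?a (Suc n)) = cls (\<lambda>_. monom c n)" for c n
    unfolding apow_completion smult_completion[OF cauchy_const] by (simp add: smult_monom)
  have "{cba.smult completion c (apow completion ?a n) | c n. 1 \<le> n}
      = (\<lambda>y. cls (\<lambda>_. y)) ` {monom c n | c n. True}" (is "?L = ?R")
  proof
    show "?L \<subseteq> ?R"
    proof
      fix x assume "x \<in> ?L"
      then obtain c n where "x = cba.smult completion c (apow completion ?a n)" "1 \<le> n" by blast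
      \<comment> \<open>Positive powers of the generator match all exponents of \<open>z\<close>
        from 0 on, which is the shift by one here.\<close>
      then have "x = cls (\<lambda>_. monom c (n - 1))" using scaled[of c "n - 1"] by simp
      then show "x \<in> ?R" by blast
    qed
    show "?R \<subseteq> ?L"
    proof
      fix x assume "x \<in> ?R"
      then obtain c n where "x = cba.smult completion c (apow completion ?a (Suc n))"
        using scaled by auto
      then show "x \<in> ?L" by force
    qed
  qed
  moreover have "dense_in completion ?R"
    by (rule dense_completion) (use assms(1) in blast)
  ultimately have "supercyclic_elem completion ?a" unfolding supercyclic_elem_def using a by simp
  moreover have "{fst (umult completion (upow completion (?a, 1) n) (?a, 0)) | n. 1 \<le> n}
      = (\<lambda>y. cls (\<lambda>_. y)) ` {[:1, 1:] ^ n | n. 0 < n}"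
    unfolding umult_upow_completion by (auto simp: Suc_le_eq)
  moreover have "dense_in completion ((\<lambda>y. cls (\<lambda>_. y)) ` {[:1, 1:] ^ n | n. 0 < n})"
    by (rule dense_completion) (use assms(2) in blast)
  ultimately show ?thesis
    unfolding chaotic_elem_def almost_hypercyclic_elem_def using a by simp
qed

end

theorem theorem1p2:
  shows "\<exists>(A :: (nat \<Rightarrow> complex) cba).
           banach_algebra A \<and> infinite_dimensional A \<and> chaotic_algebra A"
proof -
  obtain S where S: "poly_alg_seminorm S" "\<And>g. g \<noteq> 0 \<Longrightarrow> 0 < S g"
    "\<And>q e. 0 < e \<Longrightarrow> \<exists>c n. S (q - monom c n) < e"
    "\<And>q e. 0 < e \<Longrightarrow> \<exists>n>0. S (q - [:1, 1:] ^ n) < e"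
    by (rule exists_chaotic_norm) blast
  interpret poly_alg_seminorm S by (rule S(1))
  have "chaotic_elem completion (cls (\<lambda>_. 1))" by (rule chaotic_elem_completion) (fact S)+
  then have "chaotic_algebra completion"
    unfolding chaotic_algebra_def chaotic_elem_def supercyclic_elem_def by blast
  moreover have "infinite_dimensional completion" using S(2) by (rule infinite_dimensional_completion)
  ultimately show ?thesis using banach_algebra_completion by blast
qed

end
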